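(* If $G$ is a planar graph with girth at least $10$, then $\chi_{\mathsf{o}}(G) \le 4$.
   Context: An odd coloring of a graph $G$ is a proper vertex coloring of $G$ such that every non-isolated vertex $v$ has some color that appears an odd number of times among the colors of the neighbors of $v$. The odd chromatic number $\chi_{\mathsf{o}}(G)$ is the minimum number of colors in an odd coloring of $G$. The girth of $G$ is the length of a shortest cycle in $G$ (infinite if $G$ is acyclic). *)

theory Defs
  imports
    "HOL-Analysis.Analysis"
    "HOL-Library.Extended_Nat"
    "Graph_Theory.Pair_Digraph"
begin

text \<open>
  A finite simple undirected graph is represented as a finite, symmetric, loop-free
  digraph without parallel arcs (locale \<^locale>\<open>pair_graph\<close>): the undirected edge
  \<open>uv\<close> is the pair of opposite arcs \<open>(u, v)\<close> and \<open>(v, u)\<close>.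
\<close>

definition edges :: "'a pair_pre_digraph \<Rightarrow> 'a set set" where
  "edges G = {{u, v} | u v. (u, v) \<in> parcs G}"

definition nbrs :: "'a pair_pre_digraph \<Rightarrow> 'a \<Rightarrow> 'a set" where
  "nbrs G v = {u. (v, u) \<in> parcs G}"

text \<open>
  In a symmetric digraph the closed walk \<open>u, v, u\<close> along an edge and back satisfies
  \<^const>\<open>pre_digraph.cycle\<close>; the bound on the length excludes it.  The infimum of the
  empty set is \<open>\<infinity>\<close>, which is the girth of an acyclic graph.
\<close>

definition girth :: "'a pair_pre_digraph \<Rightarrow> enat" where
  "girth G = (INF p \<in> {p. pre_digraph.cycle (with_proj G) p \<and> 3 \<le> length p}. enat (length p))"

text \<open>
  The plane is the type of complex numbers, as in the Jordan curve theorem of the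
  library.  Edges are drawn as simple arcs joining their end vertices; an arc passes
  through no other vertex, and two distinct arcs meet only in common end vertices.
\<close>

definition plane_drawing ::
    "'a pair_pre_digraph \<Rightarrow> ('a \<Rightarrow> complex) \<Rightarrow> ('a set \<Rightarrow> real \<Rightarrow> complex) \<Rightarrow> bool" where
  "plane_drawing G pos \<gamma> \<longleftrightarrow>
     inj_on pos (pverts G) \<and>
     (\<forall>e \<in> edges G. arc (\<gamma> e) \<and> {pathstart (\<gamma> e), pathfinish (\<gamma> e)} = pos ` e \<and>
        path_image (\<gamma> e) \<inter> pos ` pverts G = pos ` e) \<and>
     (\<forall>e \<in> edges G. \<forall>f \<in> edges G. e \<noteq> f \<longrightarrow>
        path_image (\<gamma> e) \<inter> path_image (\<gamma> f) = pos ` (e \<inter> f))"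

definition planar :: "'a pair_pre_digraph \<Rightarrow> bool" where
  "planar G \<longleftrightarrow> (\<exists>pos \<gamma>. plane_drawing G pos \<gamma>)"

definition proper_coloring :: "'a pair_pre_digraph \<Rightarrow> ('a \<Rightarrow> 'c) \<Rightarrow> bool" where
  "proper_coloring G c \<longleftrightarrow> (\<forall>(u, v) \<in> parcs G. c u \<noteq> c v)"

definition odd_coloring :: "'a pair_pre_digraph \<Rightarrow> ('a \<Rightarrow> 'c) \<Rightarrow> bool" where
  "odd_coloring G c \<longleftrightarrow> proper_coloring G c \<and>
     (\<forall>v \<in> pverts G. nbrs G v \<noteq> {} \<longrightarrow> (\<exists>k. odd (card {u \<in> nbrs G v. c u = k})))"

definition odd_chromatic_number :: "'a pair_pre_digraph \<Rightarrow> nat" where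
  "odd_chromatic_number G =
     (LEAST k. \<exists>c :: 'a \<Rightarrow> nat. odd_coloring G c \<and> card (c ` pverts G) = k)"

text \<open>The minimum is over a nonempty set: an injective coloring is odd.\<close>

lemma (in pair_graph) odd_coloring_exists: "\<exists>c :: 'a \<Rightarrow> nat. odd_coloring G c"
proof -
  obtain c :: "'a \<Rightarrow> nat" where c: "inj_on c (pverts G)"
    using finite_imp_inj_to_nat_seg[OF pair_finite_verts] by blast
  have "c u \<noteq> c v" if "(u, v) \<in> parcs G" for u v
    using that c pair_no_loops[OF that] in_arcsD1[OF that] in_arcsD2[OF that]
    by (auto dest: inj_onD)
  moreover have "\<exists>k. odd (card {u \<in> nbrs G v. c u = k})" if ne: "nbrs G v \<noteq> {}" for v
  proof -
    from ne obtain w where w: "w \<in> nbrs G v" by blast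
    have "nbrs G v \<subseteq> pverts G" by (auto simp: nbrs_def dest: in_arcsD2)
    then have "{u \<in> nbrs G v. c u = c w} = {w}"
      using w c by (auto dest: inj_onD)
    then have "odd (card {u \<in> nbrs G v. c u = c w})" by simp
    then show ?thesis by blast
  qed
  ultimately have "odd_coloring G c"
    by (auto simp: odd_coloring_def proper_coloring_def)
  then show ?thesis by blast
qed

end

theory Submission
  imports Defs
begin

text \<open>
  A plane graph of girth at least 10 has \<open>4 m < 5 n\<close> for every subgraph: every edge on a cycle separates
  two faces (Jordan curve theorem), so a subgraph with a cycle has at least \<open>m - n + 2\<close> faces; every face
  touches at least 10 edges, because a forest does not separate the plane (Janiszewski); and every edge
  touches at most two faces. For the last point, if a crosscut \<open>e\<close> of a component of \<open>- K\<close> had three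
  sides with points \<open>x\<^sub>1, x\<^sub>2, x\<^sub>3\<close>, some nontrivial product of powers of the \<open>z - x\<^sub>i\<close> would have a
  continuous logarithm on \<open>K \<union> e\<close>, which is impossible around a bounded component.

  A minimal induced subgraph without an odd 4-coloring is then excluded by discharging. Vertices of odd
  degree are always satisfied, and a colored vertex \<open>y\<close> forbids its next neighbour at most two colors, its
  own one and a color \<open>ob y\<close>, the latter only if its degree is even. A leg of \<open>x\<close> is a maximal path of
  2-vertices starting next to \<open>x\<close>. Deleting a vertex with its legs and recoloring it shows that legs have
  at most 3 vertices (at most 1 at a vertex of odd degree), and that a vertex with a long leg has many legs
  of length 0 or 1. If every vertex of degree at least 3 gives charge 1 to each vertex on its legs, the only vertices
  left with a deficit are those of degree 4 with legs of length 3, 3, 1, 0; they receive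
  1 from the neighbour at the leg of length 0. Girth 10 guarantees that
  the deleted vertices, and the neighbours around them, are distinct.
\<close>

section \<open>Crosscuts of the plane\<close>

text \<open>Charges: a vertex of degree \<open>d\<close> starts with \<open>4 d - 10\<close>, so the
  total is \<open>2 (4 m - 5 n) < 0\<close>. A 2-vertex lacks exactly 2, one unit from either end of
  its path of 2-vertices. Colors: parity is the difficulty. Odd degree settles it; at an even vertex
  it suffices that one child may take two different colors while its siblings keep theirs. So two
  questions are asked of a deleted tree: may its parent have a given color
  (\<open>passable\<close>), and does this leave two colors at its root (\<open>flexible\<close>)?
  Obstacle: a kept vertex with one deleted neighbour stays satisfied if a single old color keeps its
  odd count, so one spoiling color per kept vertex is enough. With two deleted neighbours this would
  fail. Hence every kept vertex must be attached only once to the deleted tree, and there girth 10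
  is exhausted: a branch through a poor neighbour and a leg reach up to 5 and 4 vertices away from
  the root, giving walks with up to 10 vertices.\<close>

lemma no_continuous_log_power_circle:
  fixes x :: complex and k :: int
  assumes "0 < R" "continuous_on (sphere x R) l"
    and exp_l: "\<And>z. z \<in> sphere x R \<Longrightarrow> exp (l z) = (z - x) powi k"
  shows "k = 0"
proof -
  \<comment> \<open>Compares \<open>l\<close> along the circle with the explicit logarithm in polar
    coordinates. The difference takes values in the discrete set of periods of \<open>exp\<close>,
    so it is constant, whereas the explicit logarithm gains \<open>2 * pi * k\<close> times the
    imaginary unit in one turn.\<close>
  define \<phi> where "\<phi> t = l (x + of_real R * exp (\<i> * of_real t)) - of_int k * (of_real (ln R) + \<i> * of_real t)" for t :: real
  have cont: "continuous_on {0..2*pi} \<phi>"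
    unfolding \<phi>_def
    by (intro continuous_intros continuous_on_compose2[OF assms(2)])
       (use \<open>0 < R\<close> in \<open>auto simp: dist_norm norm_mult\<close>)
  have one: "exp (\<phi> t) = 1" for t
  proof -
    define z where "z = x + of_real R * exp (\<i> * of_real t)"
    have "z \<in> sphere x R" using \<open>0 < R\<close> by (auto simp: z_def dist_norm norm_mult)
    then have "exp (l z) = (of_real R * exp (\<i> * of_real t)) powi k"
      using exp_l by (simp add: z_def)
    also have "of_real R * exp (\<i> * of_real t) = exp (of_real (ln R) + \<i> * of_real t)"
      using \<open>0 < R\<close> by (simp add: exp_add exp_of_real)
    also have "\<dots> powi k = exp (of_int k * (of_real (ln R) + \<i> * of_real t))"
      by (simp add: exp_power_int)
    finally show ?thesis by (simp add: \<phi>_def z_def exp_diff)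
  qed
  have "\<phi> constant_on {0..2*pi}"
  proof (rule continuous_discrete_range_constant[OF _ cont])
    fix s assume "s \<in> {0..2*pi}"
    have "2*pi \<le> norm (\<phi> t - \<phi> s)" if "\<phi> t \<noteq> \<phi> s" for t
    proof -
      obtain m where m: "\<phi> t = \<phi> s + of_int (2*m) * (of_real pi * \<i>)"
        using one[of t] one[of s] exp_eq[of "\<phi> t" "\<phi> s"] by (auto simp: mult.assoc)
      with that have "m \<noteq> 0" by auto
      then have "1 \<le> \<bar>real_of_int m\<bar>" by linarith
      moreover have "norm (\<phi> t - \<phi> s) = \<bar>real_of_int m\<bar> * (2*pi)"
        by (simp add: m norm_mult)
      ultimately show ?thesis by simp
    qed
    then show "\<exists>e>0. \<forall>t. t \<in> {0..2*pi} \<and> \<phi> t \<noteq> \<phi> s \<longrightarrow> e \<le> norm (\<phi> t - \<phi> s)"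
      by (intro exI[of _ "2*pi"]) auto
  qed auto
  then have "\<phi> 0 = \<phi> (2*pi)"
    unfolding constant_on_def by (metis atLeastAtMost_iff order_refl pi_ge_zero mult_nonneg_nonneg zero_le_numeral)
  moreover have "exp (\<i> * of_real (2*pi)) = 1"
    by (simp add: exp_eq_1)
  ultimately show ?thesis
    by (simp add: \<phi>_def algebra_simps)
qed

text \<open>Otherwise \<open>(z - x)\<^sup>k\<close>, modified inside \<open>U\<close>, would be a nonvanishing function on the whole plane.\<close>

lemma no_continuous_log_bounded_component:
  fixes U L :: "complex set" and k :: int
  assumes "open U" "bounded U" "closed L" "frontier U \<subseteq> L" "x \<in> U"
    and contg: "continuous_on L g" and contr: "continuous_on (closure U) r"
    and r0: "\<And>z. z \<in> closure U \<Longrightarrow> r z \<noteq> 0"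
    and eq: "\<And>z. z \<in> L \<Longrightarrow> exp (g z) = (z - x) powi k * r z"
  shows "k = 0"
proof -
  obtain g' where g': "continuous_on UNIV g'" "\<And>z. z \<in> L \<Longrightarrow> g' z = g z"
    using Tietze_unbounded[of L g UNIV] contg \<open>closed L\<close> by auto
  define \<phi> where "\<phi> z = (if z \<in> closure U then exp (g' z) / r z else (z - x) powi k)" for z
  have "continuous_on (closure U \<union> (- U)) \<phi>"
    unfolding \<phi>_def
  proof (rule continuous_on_cases)
    show "continuous_on (closure U) (\<lambda>z. exp (g' z) / r z)"
      by (intro continuous_intros continuous_on_subset[OF g'(1)] contr) (auto simp: r0)
    show "continuous_on (- U) (\<lambda>z. (z - x) powi k)"
      using \<open>x \<in> U\<close> by (intro continuous_intros) auto
    show "\<forall>z. z \<in> closure U \<and> z \<notin> closure U \<or> z \<in> - U \<and> z \<in> closure U \<longrightarrow>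
        exp (g' z) / r z = (z - x) powi k"
    proof (intro allI impI)
      fix z assume z: "z \<in> closure U \<and> z \<notin> closure U \<or> z \<in> - U \<and> z \<in> closure U"
      then have "z \<in> closure U" by blast
      from z have "z \<in> L" using assms(1,4) by (auto simp: frontier_def interior_open)
      then show "exp (g' z) / r z = (z - x) powi k"
          using eq r0[OF \<open>z \<in> closure U\<close>] g'(2) by simp
    qed
  qed (use \<open>open U\<close> in auto)
  moreover have "closure U \<union> (- U) = UNIV" using closure_subset by blast
  ultimately have cont: "continuous_on UNIV \<phi>" by simp
  have nz: "\<phi> z \<noteq> 0" for z
    using r0 \<open>x \<in> U\<close> closure_subset by (auto simp: \<phi>_def power_int_eq_0_iff)
  obtain l where l: "continuous_on UNIV l" "\<And>z. \<phi> z = exp (l z)"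
    using continuous_logarithm_on_contractible[OF cont contractible_UNIV nz] by auto
  \<comment> \<open>Outside \<open>closure U\<close> the glued function is the pure power, so its
    logarithm can be restricted to a large circle.\<close>
  obtain R where R: "0 < R" "closure U \<subseteq> ball x R"
    using bounded_subset_ballD[of "closure U" x] \<open>bounded U\<close> by auto
  show ?thesis
  proof (rule no_continuous_log_power_circle[OF R(1)])
    show "continuous_on (sphere x R) l" using l(1) continuous_on_subset by blast
    fix z assume "z \<in> sphere x R"
    then have "z \<notin> closure U" using R(2) by (auto simp: subset_iff)
    then show "exp (l z) = (z - x) powi k" using l(2)[of z] by (simp add: \<phi>_def)
  qed
qed

text \<open>Since \<open>a\<close> and \<open>b\<close> share a component of the complement, their
  Borsuk maps into the unit circle are homotopic on \<open>S\<close>. The quotient therefore has a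
  continuous real argument, and the logarithms of the moduli complete it.\<close>

lemma continuous_log_ratio:
  fixes a b :: complex
  assumes "compact S" "connected_component (- S) a b"
  obtains g where "continuous_on S g" "\<And>z. z \<in> S \<Longrightarrow> exp (g z) = (z - a) / (z - b)"
proof -
  have ab: "a \<notin> S" "b \<notin> S"
    using assms(2) connected_component_in by fastforce+
  obtain g where contg: "continuous_on S g"
             and g: "\<And>x. x \<in> S \<Longrightarrow> exp (\<i>* of_real (g x)) = (x - a) /\<^sub>R cmod (x - a) / ((x - b) /\<^sub>R cmod (x - b))"
    using assms ab
    apply (simp add: Borsuk_maps_homotopic_in_connected_component_eq [symmetric])
    apply (subst (asm) homotopic_circlemaps_divide)
    apply (auto simp: inessential_eq_continuous_logarithm_circle)
    done
  define G where "G z = of_real (ln (cmod (z - a)) - ln (cmod (z - b))) + \<i> * of_real (g z)" for z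
  show ?thesis
  proof
    show "continuous_on S G"
      unfolding G_def using ab by (intro continuous_intros contg) auto
    fix z assume "z \<in> S"
    then have "z \<noteq> a" "z \<noteq> b" using ab by auto
    moreover have "exp (G z) = of_real (cmod (z - a) / cmod (z - b)) * exp (\<i> * of_real (g z))"
      using \<open>z \<noteq> a\<close> \<open>z \<noteq> b\<close> unfolding G_def exp_add exp_of_real by (simp add: exp_diff)
    moreover have "exp (\<i> * of_real (g z)) =
        (inverse (of_real (cmod (z - a))) * (z - a)) / (inverse (of_real (cmod (z - b))) * (z - b))"
      using g[OF \<open>z \<in> S\<close>] by (simp add: scaleR_conv_of_real)
    ultimately show "exp (G z) = (z - a) / (z - b)"
      by (simp add: mult.assoc[symmetric])
  qed
qed

lemma bounded_one_of_two_components: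
  fixes L :: "complex set"
  assumes "compact L" "C \<in> components (- L)" "D \<in> components (- L)" "C \<noteq> D"
  shows "bounded C \<or> bounded D"
  using cobounded_unique_unbounded_components[of "- L" C D] assms compact_imp_bounded by auto

text \<open>The points \<open>x2\<close> and \<open>x3\<close> lie outside
  \<open>closure C1\<close>, so their powers form a nonvanishing factor there and the exponent at
  \<open>x1\<close> must vanish. Each of the three components is later put in first place.\<close>

lemma no_log_of_three_powers:
  fixes L :: "complex set" and k1 k2 k3 :: int
  assumes L: "compact L"
    and C: "C1 \<in> components (- L)" "C2 \<in> components (- L)" "C3 \<in> components (- L)"
    and ne: "C1 \<noteq> C2" "C1 \<noteq> C3"
    and x: "x1 \<in> C1" "x2 \<in> C2" "x3 \<in> C3"
    and bd: "bounded C1"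
    and g: "continuous_on L g" "\<And>z. z \<in> L \<Longrightarrow> exp (g z) = (z - x1) powi k1 * ((z - x2) powi k2 * (z - x3) powi k3)"
  shows "k1 = 0"
proof (rule no_continuous_log_bounded_component[OF _ bd _ _ x(1) g(1) _ _ g(2)])
  have op: "open (- L)" using L compact_imp_closed by auto
  show "open C1" using C(1) op open_components by blast
  show "closed L" using L compact_imp_closed by auto
  show fr: "frontier C1 \<subseteq> L" 
    using frontier_of_components_closed_complement[OF \<open>closed L\<close> C(1)] .
  have "C1 \<inter> C2 = {}" "C1 \<inter> C3 = {}"
    using components_nonoverlap[OF C(1) C(2)] components_nonoverlap[OF C(1) C(3)] ne by auto
  moreover have "x2 \<notin> L" "x3 \<notin> L" using C x in_components_subset by fastforce+
  ultimately have no: "x2 \<notin> closure C1" "x3 \<notin> closure C1"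
    using x fr \<open>open C1\<close> by (auto simp: frontier_def interior_open)
  show "continuous_on (closure C1) (\<lambda>z. (z - x2) powi k2 * (z - x3) powi k3)"
    by (intro continuous_intros) (use no in auto)
  show "(z - x2) powi k2 * (z - x3) powi k3 \<noteq> 0" if "z \<in> closure C1" for z
    using no that by (auto simp: power_int_eq_0_iff)
qed

lemma crosscut_no_three_components:
  fixes K :: "complex set" and e :: "real \<Rightarrow> complex"
  assumes K: "compact K" and e: "arc e"
    and Ke: "K \<inter> path_image e = {pathstart e, pathfinish e}"
    and C: "C1 \<in> components (- (K \<union> path_image e))" "C2 \<in> components (- (K \<union> path_image e))"
      "C3 \<in> components (- (K \<union> path_image e))"
    and ne: "C1 \<noteq> C2" "C1 \<noteq> C3" "C2 \<noteq> C3"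
    and x: "x1 \<in> C1" "x2 \<in> C2" "x3 \<in> C3"
    and cc: "connected_component (- K) x1 x2" "connected_component (- K) x1 x3"
  shows False
proof -
  define P where "P = path_image e"
  define a b where "a = pathstart e" and "b = pathfinish e"
  define L where "L = K \<union> P"
  have P: "compact P" "contractible P"
    unfolding P_def using e 
    using homeomorphic_arc_image_interval[OF e, of 0 "1::real"] homeomorphic_contractible_eq[of "path_image e" "{0..1::real}"]
    by (auto intro: compact_arc_image convex_imp_contractible)
  have L: "compact L" using K P by (auto simp: L_def)
  have xL: "x1 \<notin> L" "x2 \<notin> L" "x3 \<notin> L"
    using C x in_components_subset unfolding L_def P_def by fastforce+
  have aK: "a \<in> K" "b \<in> K" "a \<in> P" "b \<in> P" and int: "K \<inter> P = {a,b}"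
    using Ke by (auto simp: a_def b_def P_def)
  \<comment> \<open>On \<open>K\<close> a logarithm exists because \<open>x1\<close> and
    \<open>x\<close> share a component of the complement, on \<open>P\<close> because an arc is
    contractible. A shift makes them agree at \<open>a\<close>; the integer \<open>n\<close> at
    \<open>b\<close> is the only obstruction to gluing.\<close>
  have ex: "\<exists>g h n. continuous_on K g \<and> continuous_on P h \<and> (\<forall>z\<in>K. exp (g z) = (z - x1) / (z - x)) \<and>
      (\<forall>z\<in>P. exp (h z) = (z - x1) / (z - x)) \<and> g a = h a \<and> g b = h b + of_int n * (2 * of_real pi * \<i>)"
    if cx: "connected_component (- K) x1 x" and x: "x \<notin> L" for x
  proof -
    obtain g where g: "continuous_on K g" "\<And>z. z \<in> K \<Longrightarrow> exp (g z) = (z - x1) / (z - x)"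
      using continuous_log_ratio[OF K cx] by blast
    obtain h where h: "continuous_on P h" "\<And>z. z \<in> P \<Longrightarrow> (z - x1) / (z - x) = exp (h z)"
    proof (rule continuous_logarithm_on_contractible[of P "\<lambda>z. (z - x1) / (z - x)"])
      show "continuous_on P (\<lambda>z. (z - x1) / (z - x))"
        using x xL by (intro continuous_intros) (auto simp: L_def)
    qed (use P x xL in \<open>auto simp: L_def\<close>)
    define h' where "h' z = h z + (g a - h a)" for z
    have "exp (g a - h a) = 1"
      using g(2) h(2)[symmetric] aK x xL by (auto simp: exp_diff L_def)
    then have h': "exp (h' z) = (z - x1) / (z - x)" if "z \<in> P" for z
      using h(2) that by (simp add: h'_def exp_add)
    have "exp (g b) = exp (h' b)" using g(2) h' aK by simp
    then obtain n where "g b = h' b + of_int (2*n) * (of_real pi * \<i>)" by (auto simp: exp_eq mult.assoc)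
    then have "g b = h' b + of_int n * (2 * of_real pi * \<i>)" by simp
    moreover have "continuous_on P h'" unfolding h'_def by (intro continuous_intros h)
    ultimately show ?thesis using g h' unfolding h'_def
      by (intro exI[of _ g] exI[of _ h'] exI[of _ n]) (auto simp: h'_def)
  qed
  obtain g2 h2 n2 where 2: "continuous_on K g2" "continuous_on P h2" "\<And>z. z\<in>K \<Longrightarrow> exp (g2 z) = (z - x1) / (z - x2)"
      "\<And>z. z\<in>P \<Longrightarrow> exp (h2 z) = (z - x1) / (z - x2)" "g2 a = h2 a" "g2 b = h2 b + of_int n2 * (2 * of_real pi * \<i>)"
    using ex[OF cc(1) xL(2)] by blast
  obtain g3 h3 n3 where 3: "continuous_on K g3" "continuous_on P h3" "\<And>z. z\<in>K \<Longrightarrow> exp (g3 z) = (z - x1) / (z - x3)"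
      "\<And>z. z\<in>P \<Longrightarrow> exp (h3 z) = (z - x1) / (z - x3)" "g3 a = h3 a" "g3 b = h3 b + of_int n3 * (2 * of_real pi * \<i>)"
    using ex[OF cc(2) xL(3)] by blast
  \<comment> \<open>Both logarithms jump by a multiple of the period at \<open>b\<close>; an integer combination has no jump.\<close>
  have "\<exists>p q :: int. (p \<noteq> 0 \<or> q \<noteq> 0) \<and> p * n2 + q * n3 = 0"
  proof (cases "n2 = 0 \<and> n3 = 0")
    case True then show ?thesis by (intro exI[of _ 1]) auto
  next
    case False then show ?thesis by (intro exI[of _ n3] exI[of _ "- n2"]) auto
  qed
  then obtain p q :: int where pq: "p \<noteq> 0 \<or> q \<noteq> 0" "p * n2 + q * n3 = 0" by blast
  define G where "G z = (if z \<in> K then of_int p * g2 z + of_int q * g3 z else of_int p * h2 z + of_int q * h3 z)" for z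
  have contG: "continuous_on L G"
    unfolding G_def L_def
  proof (rule continuous_on_cases)
    show "closed K" "closed P" using K P compact_imp_closed by auto
    show "continuous_on K (\<lambda>z. of_int p * g2 z + of_int q * g3 z)" by (intro continuous_intros 2 3)
    show "continuous_on P (\<lambda>z. of_int p * h2 z + of_int q * h3 z)" by (intro continuous_intros 2 3)
    have "of_int p * g2 b + of_int q * g3 b = of_int p * h2 b + of_int q * h3 b + of_int (p * n2 + q * n3) * (2 * of_real pi * \<i>)"
      by (simp add: 2(6) 3(6) algebra_simps)
    then have "of_int p * g2 b + of_int q * g3 b = of_int p * h2 b + of_int q * h3 b" using pq by simp
    then show "\<forall>x. x \<in> K \<and> x \<notin> K \<or> x \<in> P \<and> x \<in> K \<longrightarrow>
        of_int p * g2 x + of_int q * g3 x = of_int p * h2 x + of_int q * h3 x"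
      using int 2(5) 3(5) by (metis Int_iff insert_iff singletonD)
  qed
  have expG: "exp (G z) = (z - x1) powi (p + q) * ((z - x2) powi (- p) * (z - x3) powi (- q))" if "z \<in> L" for z
  proof -
    have nz: "z - x1 \<noteq> 0" "z - x2 \<noteq> 0" "z - x3 \<noteq> 0" using that xL by auto
    have "exp (G z) = ((z - x1) / (z - x2)) powi p * ((z - x1) / (z - x3)) powi q"
      using that 2 3 by (auto simp: G_def L_def exp_add exp_power_int[symmetric])
    then show ?thesis using nz by (simp add: power_int_divide_distrib power_int_add power_int_minus field_simps)
  qed
  have 1: "p + q = 0" if "bounded C1"
    by (rule no_log_of_three_powers[OF L C[folded P_def, folded L_def] ne(1,2) x that contG expG])
  have 4: "- p = 0" if "bounded C2"
    by (rule no_log_of_three_powers[OF L, of C2 C1 C3 x2 x1 x3 G "-p" "p+q" "-q"])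
       (use C[folded P_def, folded L_def] ne x that contG expG in \<open>auto simp: mult_ac\<close>)
  have 5: "- q = 0" if "bounded C3"
    by (rule no_log_of_three_powers[OF L, of C3 C1 C2 x3 x1 x2 G "-q" "p+q" "-p"])
       (use C[folded P_def, folded L_def] ne x that contG expG in \<open>auto simp: mult_ac\<close>)
  \<comment> \<open>The exponents \<open>p + q\<close>, \<open>- p\<close>, \<open>- q\<close> sum
    to zero, and at most one component is unbounded. So two exponents vanish, hence all three,
    against the choice of \<open>p\<close> and \<open>q\<close>.\<close>
  have "bounded C1 \<or> bounded C2" "bounded C1 \<or> bounded C3" "bounded C2 \<or> bounded C3"
    using bounded_one_of_two_components[OF L] C[folded P_def, folded L_def] ne by blast+
  then show False using 1 4 5 pq by auto
qed

section \<open>Cycles and forests\<close>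

fun path_edges :: "'a list \<Rightarrow> 'a set set" where
  "path_edges (u # v # r) = insert {u, v} (path_edges (v # r))"
| "path_edges _ = {}"

lemma path_edges_subset: "f \<in> path_edges vs \<Longrightarrow> f \<subseteq> set vs"
  by (induction vs rule: path_edges.induct) auto

lemma card_path_edges: "distinct vs \<Longrightarrow> vs \<noteq> [] \<Longrightarrow> finite (path_edges vs) \<and> Suc (card (path_edges vs)) = length vs"
proof (induction vs rule: path_edges.induct)
  case (1 u v r)
  then have "{u, v} \<notin> path_edges (v # r)" using path_edges_subset[of "{u, v}" "v # r"] by auto
  then show ?case using 1 by auto
qed auto

lemma closing_edge_notin_path_edges:
  assumes "distinct vs" "3 \<le> length vs"
  shows "{last vs, hd vs} \<notin> path_edges vs"
proof -
  obtain u v w r' where "vs = u # v # w # r'"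
    using assms(2) by (auto simp: numeral_3_eq_3 Suc_le_length_iff)
  then obtain r where vs: "vs = u # v # r" "r \<noteq> []" by blast
  have "last vs \<in> set r" using vs by auto
  then have "{last vs, u} \<noteq> {u, v}" using assms(1) vs by (auto simp: doubleton_eq_iff)
  moreover have "{last vs, u} \<notin> path_edges (v # r)"
    using path_edges_subset[of "{last vs, u}" "v # r"] assms(1) vs by auto
  ultimately show ?thesis using vs(1) by simp
qed

definition cycle_in :: "'a set set \<Rightarrow> 'a list \<Rightarrow> bool" where
  "cycle_in F vs \<longleftrightarrow> distinct vs \<and> 3 \<le> length vs \<and> successively (\<lambda>u v. {u, v} \<in> F) vs \<and> {last vs, hd vs} \<in> F"

lemma cycle_in_mono:
  assumes "cycle_in F vs" "F \<subseteq> F'"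
  shows "cycle_in F' vs"
proof -
  have "successively (\<lambda>u v. {u, v} \<in> F') vs"
    by (rule successively_mono[of "\<lambda>u v. {u, v} \<in> F"]) (use assms in \<open>auto simp: cycle_in_def\<close>)
  then show ?thesis using assms by (auto simp: cycle_in_def)
qed

lemma successively_path_edges: "successively (\<lambda>u v. {u, v} \<in> F) vs \<Longrightarrow> path_edges vs \<subseteq> F"
  by (induction vs rule: path_edges.induct) auto

text \<open>Turns the girth bound, which counts vertices, into a bound on the edges touched by a
  face.\<close>

lemma cycle_in_card:
  assumes "cycle_in F vs" "finite F"
  shows "length vs \<le> card F"
proof -
  have d: "distinct vs" "3 \<le> length vs" "path_edges vs \<subseteq> F" "{last vs, hd vs} \<in> F"
    using assms successively_path_edges by (auto simp: cycle_in_def)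
  have ne: "vs \<noteq> []" using d by auto
  have "card (insert {last vs, hd vs} (path_edges vs)) = length vs"
    using card_path_edges[OF d(1) ne] closing_edge_notin_path_edges[OF d(1,2)] by simp
  moreover have "card (insert {last vs, hd vs} (path_edges vs)) \<le> card F"
    using d assms(2) by (intro card_mono) auto
  ultimately show ?thesis by simp
qed

text \<open>Forests, in the form that suits induction by removal of leaves.\<close>

definition leafy :: "'a set set \<Rightarrow> bool" where
  "leafy F \<longleftrightarrow> (\<forall>F'\<subseteq>F. F' \<noteq> {} \<longrightarrow> (\<exists>e\<in>F'. \<exists>v\<in>e. \<forall>f\<in>F'. v \<in> f \<longrightarrow> f = e))"

lemma leafy_subset: "leafy F \<Longrightarrow> F' \<subseteq> F \<Longrightarrow> leafy F'"
  unfolding leafy_def by (meson order_trans)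

text \<open>Take a longest path in a set \<open>F'\<close> without leaves. The second edge at its
  first vertex cannot prolong it, so it leads back to the path and closes a cycle.\<close>

lemma not_leafy_cycle:
  assumes fin: "finite F" and two: "\<And>e. e \<in> F \<Longrightarrow> \<exists>u v. u \<noteq> v \<and> e = {u, v}" and "\<not> leafy F"
  shows "\<exists>vs. cycle_in F vs"
proof -
  obtain F' where F': "F' \<subseteq> F" "F' \<noteq> {}" and nl: "\<not> (\<exists>e\<in>F'. \<exists>v\<in>e. \<forall>f\<in>F'. v \<in> f \<longrightarrow> f = e)"
    using assms(3) unfolding leafy_def by metis
  have leaf: "\<exists>f\<in>F'. v \<in> f \<and> f \<noteq> e" if "e \<in> F'" "v \<in> e" for e v
    using nl that by blast
  let ?adj = "\<lambda>u v. {u, v} \<in> F'"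
  define P where "P vs \<longleftrightarrow> distinct vs \<and> 2 \<le> length vs \<and> successively ?adj vs" for vs
  have finU: "finite (\<Union>F')" using fin F'(1) two
    by (metis finite.emptyI finite.insertI finite_Union finite_subset subsetD)
  have sub: "set vs \<subseteq> \<Union>F'" if "P vs" for vs
  proof -
    have "successively ?adj (v # r) \<Longrightarrow> r \<noteq> [] \<Longrightarrow> set (v # r) \<subseteq> \<Union>F'" for v r
    proof (induction r arbitrary: v)
      case (Cons w r)
      then show ?case by (cases r) auto
    qed simp
    moreover have "vs \<noteq> []" "successively ?adj vs" using that by (auto simp: P_def)
    moreover have "tl vs \<noteq> []" using that by (cases vs) (auto simp: P_def)
    ultimately show ?thesis by (metis list.collapse)
  qed
  have bound: "length vs \<le> card (\<Union>F')" if "P vs" for vs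
    using card_mono[OF finU sub[OF that]] that by (simp add: P_def distinct_card)
  obtain e where "e \<in> F'" using F' by blast
  moreover then obtain u v where "u \<noteq> v" "e = {u, v}" using two F'(1) by blast
  ultimately have "P [u, v]" by (simp add: P_def)
  then obtain vs where vs: "P vs" "\<And>ws. P ws \<Longrightarrow> length ws \<le> length vs"
    using ex_has_greatest_nat[of P "[u, v]" length "Suc (card (\<Union>F'))"] bound by (metis less_Suc_eq_le)
  obtain a b r where abr: "vs = a # b # r" using vs(1) by (cases vs; cases "tl vs") (auto simp: P_def)
  have ab: "{a, b} \<in> F'" using vs(1) abr by (simp add: P_def)
  obtain f where f: "f \<in> F'" "a \<in> f" "f \<noteq> {a, b}" using leaf[OF ab] by auto
  obtain w where w: "f = {w, a}" "w \<noteq> a" using two[of f] f F'(1) by (auto simp: insert_commute)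
  have "w \<in> set vs"
  proof (rule ccontr)
    assume "w \<notin> set vs"
    then have "P (w # vs)" using vs(1) f w abr by (auto simp: P_def)
    then show False using vs(2) by fastforce
  qed
  moreover have "w \<noteq> b" using f w by auto
  ultimately have "w \<in> set r" using abr w by auto
  then obtain r1 r2 where r: "r = r1 @ w # r2" by (meson split_list)
  have eq: "vs = (a # b # r1 @ [w]) @ r2" using abr r by simp
  have "distinct (a # b # r1 @ [w])" using vs(1) unfolding P_def eq distinct_append by blast
  moreover have "successively ?adj (a # b # r1 @ [w])"
    using vs(1) unfolding P_def eq successively_append_iff by blast
  ultimately have "cycle_in F' (a # b # r1 @ [w])" using f(1) w(1) by (simp add: cycle_in_def)
  then show ?thesis using cycle_in_mono F'(1) by blast
qed

text \<open>Removing a leaf and its edge lowers both cardinalities by one. The other end of the edge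
  keeps the vertex set nonempty, so the induction reaches a strict base case.\<close>

lemma leafy_card:
  assumes "finite F" "leafy F" "\<And>e. e \<in> F \<Longrightarrow> \<exists>u v. u \<noteq> v \<and> e = {u, v}" "\<Union>F \<subseteq> W" "finite W" "W \<noteq> {}"
  shows "card F < card W"
  using assms
proof (induction "card F" arbitrary: F W)
  case 0
  then show ?case by (simp add: card_gt_0_iff)
next
  case (Suc n)
  then have "F \<noteq> {}" by auto
  then obtain e v where e: "e \<in> F" "v \<in> e" "\<And>f. f \<in> F \<Longrightarrow> v \<in> f \<Longrightarrow> f = e"
    using Suc.prems(2) unfolding leafy_def by (metis subset_refl)
  obtain u where u: "u \<in> e" "u \<noteq> v" using Suc.prems(3)[OF e(1)] e(2) by auto
  have n: "n = card (F - {e})" using Suc.hyps(2) e(1) Suc.prems(1) by simp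
  have "card (F - {e}) < card (W - {v})"
  proof (rule Suc.hyps(1)[OF n])
    show "leafy (F - {e})" using leafy_subset[OF Suc.prems(2)] by blast
    show "\<Union>(F - {e}) \<subseteq> W - {v}" using Suc.prems(4) e(3) by blast
    show "W - {v} \<noteq> {}" using u e(1) Suc.prems(4) by blast
  qed (use Suc.prems in auto)
  moreover have "v \<in> W" using e Suc.prems(4) by blast
  ultimately show ?case using e(1) Suc.prems(1,5) by (simp add: card_Diff_singleton_if)
qed

section \<open>Plane graphs of girth at least 10\<close>

lemma arc_interior_nonempty:
  assumes "arc g"
  shows "path_image g - {pathstart g, pathfinish g} \<noteq> {}"
proof -
  have inj: "inj_on g {0..1}" using assms by (simp add: arc_def)
  have "g (1/2) \<in> path_image g" by (auto simp: path_image_def)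
  moreover have "g (1/2) \<noteq> g 0" "g (1/2) \<noteq> g 1"
    using inj_onD[OF inj, of "1/2" 0] inj_onD[OF inj, of "1/2" 1] by auto
  ultimately show ?thesis by (auto simp: pathstart_def pathfinish_def)
qed

text \<open>Infinite sets, whose \<open>card\<close> is 0, are included: finiteness of the set of
  faces along an edge is to follow from the same contradiction as the bound 2.\<close>

lemma ex_three_subset:
  assumes "\<not> (finite A \<and> card A \<le> 2)"
  shows "\<exists>S\<subseteq>A. card S = 3"
proof (cases "finite A")
  case True
  then have "3 \<le> card A" using assms by linarith
  then show ?thesis using obtain_subset_with_card_n by metis
next
  case False
  then show ?thesis using infinite_arbitrarily_large by metis
qed

locale plane_graph =
  fixes V :: "'a set" and \<E> :: "'a set set" and pos :: "'a \<Rightarrow> complex" and \<gamma> :: "'a set \<Rightarrow> real \<Rightarrow> complex"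
  assumes finite_V: "finite V" and finite_E: "finite \<E>"
    and edge_pair: "e \<in> \<E> \<Longrightarrow> \<exists>u v. u \<noteq> v \<and> e = {u, v}" and edge_subset: "e \<in> \<E> \<Longrightarrow> e \<subseteq> V"
    and inj_pos: "inj_on pos V"
    and arc_edge: "e \<in> \<E> \<Longrightarrow> arc (\<gamma> e)"
    and edge_ends: "e \<in> \<E> \<Longrightarrow> {pathstart (\<gamma> e), pathfinish (\<gamma> e)} = pos ` e"
    and edge_verts: "e \<in> \<E> \<Longrightarrow> path_image (\<gamma> e) \<inter> pos ` V = pos ` e"
    and edge_inter: "\<lbrakk>e \<in> \<E>; f \<in> \<E>; e \<noteq> f\<rbrakk> \<Longrightarrow> path_image (\<gamma> e) \<inter> path_image (\<gamma> f) = pos ` (e \<inter> f)"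
    and girth: "cycle_in \<E> vs \<Longrightarrow> 10 \<le> length vs"
begin

definition drawn :: "'a set set \<Rightarrow> 'a set \<Rightarrow> complex set" where
  "drawn F W = (\<Union>e\<in>F. path_image (\<gamma> e)) \<union> pos ` W"

definition edge_interior :: "'a set \<Rightarrow> complex set" where
  "edge_interior e = path_image (\<gamma> e) - pos ` e"

definition faces :: "'a set set \<Rightarrow> 'a set \<Rightarrow> complex set set" where
  "faces F W = components (- drawn F W)"

definition subgraph_of :: "'a set set \<Rightarrow> 'a set \<Rightarrow> bool" where
  "subgraph_of F W \<longleftrightarrow> F \<subseteq> \<E> \<and> \<Union>F \<subseteq> W \<and> W \<subseteq> V"

lemma subgraph_ofD:
  assumes "subgraph_of F W"
  shows "F \<subseteq> \<E>" "\<Union>F \<subseteq> W" "W \<subseteq> V" "finite F" "finite W"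
  using assms finite_V finite_E finite_subset by (auto simp: subgraph_of_def)

lemma subgraph_of_mono: "subgraph_of F W \<Longrightarrow> F' \<subseteq> F \<Longrightarrow> subgraph_of F' W"
  by (auto simp: subgraph_of_def)

lemma compact_drawn:
  assumes "subgraph_of F W"
  shows "compact (drawn F W)"
proof -
  note F = subgraph_ofD[OF assms]
  have "compact (path_image (\<gamma> e))" if "e \<in> F" for e
    using compact_arc_image[OF arc_edge] that F(1) by blast
  then show ?thesis
    unfolding drawn_def using F by (intro compact_Un compact_UN finite_imp_compact[of "pos ` W"]) auto
qed

lemma closed_drawn: "subgraph_of F W \<Longrightarrow> closed (drawn F W)"
  by (simp add: compact_drawn compact_imp_closed)

lemma edge_interior_nonempty: "e \<in> \<E> \<Longrightarrow> edge_interior e \<noteq> {}"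
  unfolding edge_interior_def using arc_interior_nonempty[OF arc_edge] edge_ends by metis

lemma connected_edge_interior: "e \<in> \<E> \<Longrightarrow> connected (edge_interior e)"
  unfolding edge_interior_def
  using connected_simple_path_endless[OF arc_imp_simple_path[OF arc_edge]] edge_ends by metis

lemma edge_interior_disjoint:
  assumes "subgraph_of F W" "e \<in> \<E>" "e \<notin> F"
  shows "edge_interior e \<inter> drawn F W = {}"
proof -
  have "edge_interior e \<inter> path_image (\<gamma> f) = {}" if "f \<in> F" for f
  proof -
    have "f \<in> \<E>" "e \<noteq> f" using subgraph_ofD(1)[OF assms(1)] that assms(3) by auto
    then have "path_image (\<gamma> e) \<inter> path_image (\<gamma> f) \<subseteq> pos ` e" using edge_inter[OF assms(2)] by blast
    then show ?thesis by (auto simp: edge_interior_def)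
  qed
  moreover have "edge_interior e \<inter> pos ` W = {}"
    using edge_verts[OF assms(2)] subgraph_ofD(3)[OF assms(1)] by (auto simp: edge_interior_def)
  ultimately show ?thesis by (auto simp: drawn_def)
qed

lemma drawn_remove_edge:
  assumes "subgraph_of F W" "e \<in> F"
  shows "drawn F W = drawn (F - {e}) W \<union> path_image (\<gamma> e)"
    "drawn F W = drawn (F - {e}) W \<union> edge_interior e"
    "drawn (F - {e}) W \<inter> path_image (\<gamma> e) = pos ` e"
proof -
  have e: "e \<in> \<E>" "e \<subseteq> W" using subgraph_ofD[OF assms(1)] assms(2) by auto
  show 1: "drawn F W = drawn (F - {e}) W \<union> path_image (\<gamma> e)" using assms(2) by (auto simp: drawn_def)
  have pe: "pos ` e \<subseteq> drawn (F - {e}) W" using e by (auto simp: drawn_def)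
  then show "drawn F W = drawn (F - {e}) W \<union> edge_interior e"
    unfolding 1 by (auto simp: edge_interior_def)
  have "edge_interior e \<inter> drawn (F - {e}) W = {}"
    by (rule edge_interior_disjoint) (use e subgraph_of_mono[OF assms(1)] in auto)
  moreover have "pos ` e \<subseteq> path_image (\<gamma> e)" using edge_verts[OF e(1)] by blast
  ultimately show "drawn (F - {e}) W \<inter> path_image (\<gamma> e) = pos ` e"
    using pe by (auto simp: edge_interior_def)
qed

lemma leafy_connected_complement:
  assumes "leafy F" "subgraph_of F W"
  shows "connected (- drawn F W)"
  using assms
proof (induction "card F" arbitrary: F W)
  case 0
  then have "F = {}" using subgraph_ofD(4) by fastforce
  then have "drawn F W = pos ` W" by (simp add: drawn_def)
  moreover have "countable (pos ` W)" using subgraph_ofD(5)[OF 0(3)] by (simp add: countable_finite)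
  ultimately show ?case
    using path_connected_complement_countable[of "pos ` W"] path_connected_imp_connected by auto
next
  case (Suc n)
  note F = subgraph_ofD[OF Suc.prems(2)]
  from Suc.hyps(2) have "F \<noteq> {}" by auto
  then obtain e v where e: "e \<in> F" "v \<in> e" "\<And>f. f \<in> F \<Longrightarrow> v \<in> f \<Longrightarrow> f = e"
    using Suc.prems(1) unfolding leafy_def by (metis subset_refl)
  have eE: "e \<in> \<E>" using e(1) F(1) by blast
  obtain u where u: "e = {u, v}" "u \<noteq> v" using edge_pair[OF eE] e(2) by auto
  have n: "n = card (F - {e})" using Suc.hyps(2) e(1) F(4) by simp
  \<comment> \<open>The leaf vertex leaves \<open>W\<close> together with its edge. Were it kept,
    the two sets in Janiszewski's theorem would meet in both ends of the arc, which is not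
    connected.\<close>
  have sub: "subgraph_of (F - {e}) (W - {v})"
    using F e unfolding subgraph_of_def by blast
  have conn: "connected (- drawn (F - {e}) (W - {v}))"
    by (rule Suc.hyps(1)[OF n leafy_subset[OF Suc.prems(1)] sub]) auto
  have W: "u \<in> W" "v \<in> W" using F(2) e(1) u by auto
  have pv: "pos ` e \<subseteq> path_image (\<gamma> e)" using edge_verts[OF eE] by blast
  have un: "drawn F W = drawn (F - {e}) (W - {v}) \<union> path_image (\<gamma> e)"
    using e(1) W pv u by (auto simp: drawn_def)
  have "drawn (F - {e}) (W - {v}) \<inter> path_image (\<gamma> e) \<subseteq> {pos u}"
  proof
    fix z assume "z \<in> drawn (F - {e}) (W - {v}) \<inter> path_image (\<gamma> e)"
    then consider f where "f \<in> F - {e}" "z \<in> path_image (\<gamma> f)" "z \<in> path_image (\<gamma> e)"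
      | w where "w \<in> W - {v}" "z = pos w" "z \<in> path_image (\<gamma> e)" by (auto simp: drawn_def)
    then show "z \<in> {pos u}"
    proof cases
      case 1
      then have "z \<in> pos ` (e \<inter> f)" using edge_inter[OF eE, of f] F(1) by auto
      moreover have "v \<notin> f" using e(3) 1 by auto
      ultimately show ?thesis using u by auto
    next
      case 2
      then have "z \<in> path_image (\<gamma> e) \<inter> pos ` V" using F(3) by auto
      then have "z \<in> pos ` e" using edge_verts[OF eE] by simp
      then have "z = pos u \<or> z = pos v" using u by auto
      moreover have "z \<noteq> pos v" using 2 W(2) F(3) inj_onD[OF inj_pos, of w v] by auto
      ultimately show ?thesis by auto
    qed
  qed
  then have "connected (drawn (F - {e}) (W - {v}) \<inter> path_image (\<gamma> e))"
    by (metis connected_empty connected_sing subset_singletonD)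
  then show ?case unfolding un
    using conn compact_drawn[OF sub] connected_arc_complement[OF arc_edge[OF eE]]
      closed_arc_image[OF arc_edge[OF eE]]
    by (intro Janiszewski_connected) auto
qed

text \<open>Only the open arc counts: a face may reach an end vertex of an edge without bordering
  that edge.\<close>

definition touches :: "complex set \<Rightarrow> 'a set \<Rightarrow> bool" where
  "touches C e \<longleftrightarrow> closure C \<inter> edge_interior e \<noteq> {}"

lemma two_faces_per_edge:
  assumes sub: "subgraph_of F W" and e: "e \<in> F"
  shows "finite {C \<in> faces F W. touches C e} \<and> card {C \<in> faces F W. touches C e} \<le> 2"
proof (rule ccontr)
  assume "\<not> ?thesis"
  from ex_three_subset[OF this] obtain S where S: "S \<subseteq> {C \<in> faces F W. touches C e}" "card S = 3" by blast
  from S(2) obtain C1 C2 C3 where C: "S = {C1, C2, C3}" "C1 \<noteq> C2" "C1 \<noteq> C3" "C2 \<noteq> C3"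
    by (auto simp: card_3_iff)
  define K where "K = drawn (F - {e}) W"
  have subK: "subgraph_of (F - {e}) W" using subgraph_of_mono[OF sub] by auto
  have eE: "e \<in> \<E>" using subgraph_ofD(1)[OF sub] e by auto
  have dr: "drawn F W = K \<union> path_image (\<gamma> e)" using drawn_remove_edge(1)[OF sub e] by (simp add: K_def)
  have Ke: "K \<inter> path_image (\<gamma> e) = {pathstart (\<gamma> e), pathfinish (\<gamma> e)}"
    using drawn_remove_edge(3)[OF sub e] edge_ends[OF eE] by (simp add: K_def)
  have disj: "edge_interior e \<subseteq> - K" using edge_interior_disjoint[OF subK eE] by (auto simp: K_def)
  obtain z0 where z0: "z0 \<in> edge_interior e" using edge_interior_nonempty[OF eE] by blast
  \<comment> \<open>The open arc lies in one component \<open>X\<close> of the complement of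
    \<open>K\<close>. As \<open>X\<close> is open, every face that touches the arc has a point in
    \<open>X\<close>; these are the points for the crosscut lemma.\<close>
  define X where "X = connected_component_set (- K) z0"
  have X: "open X" "edge_interior e \<subseteq> X"
    using closed_drawn[OF subK] connected_component_maximal[OF z0 connected_edge_interior[OF eE] disj]
    by (auto simp: X_def K_def open_connected_component open_Compl)
  have ex: "\<exists>x. x \<in> C \<and> x \<in> X" and comp: "C \<in> components (- (K \<union> path_image (\<gamma> e)))" if "C \<in> S" for C
  proof -
    have C: "C \<in> faces F W" "touches C e" using that S by auto
    then obtain z where "z \<in> closure C" "z \<in> X" using X(2) by (auto simp: touches_def)
    then have "X \<inter> C \<noteq> {}" using open_Int_closure_eq_empty[OF X(1), of C] by blast
    then show "\<exists>x. x \<in> C \<and> x \<in> X" by blast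
    show "C \<in> components (- (K \<union> path_image (\<gamma> e)))" using C(1) by (simp add: faces_def dr)
  qed
  obtain x1 where x1: "x1 \<in> C1" "x1 \<in> X" using ex[of C1] C by auto
  obtain x2 where x2: "x2 \<in> C2" "x2 \<in> X" using ex[of C2] C by auto
  obtain x3 where x3: "x3 \<in> C3" "x3 \<in> X" using ex[of C3] C by auto
  have cc: "connected_component (- K) x1 y" if "y \<in> X" for y
    using x1(2) that unfolding X_def by (metis connected_component_sym connected_component_trans mem_Collect_eq)
  show False
    by (rule crosscut_no_three_components[OF compact_drawn[OF subK, folded K_def] arc_edge[OF eE] Ke
          comp comp comp C(2,3,4) x1(1) x2(1) x3(1) cc[OF x2(2)] cc[OF x3(2)]]) (use C(1) in auto)
qed

text \<open>The touched edges and the vertices cover the frontier of \<open>C\<close>. If those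
  edges form a forest, the connected complement of their drawing meets \<open>C\<close> but not its
  frontier, so it lies in \<open>C\<close>; then nothing more is drawn, and \<open>F\<close> itself
  is a forest.\<close>

lemma face_touches_many:
  assumes sub: "subgraph_of F W" and nl: "\<not> leafy F" and C: "C \<in> faces F W"
  shows "10 \<le> card {e \<in> F. touches C e}"
proof -
  let ?T = "{e \<in> F. touches C e}"
  note F = subgraph_ofD[OF sub]
  have subT: "subgraph_of ?T W" using subgraph_of_mono[OF sub] by auto
  have "\<not> leafy ?T"
  proof
    assume leafy: "leafy ?T"
    have conn: "connected (- drawn ?T W)" by (rule leafy_connected_complement[OF leafy subT])
    have Csub: "C \<subseteq> - drawn F W" using C in_components_subset by (auto simp: faces_def)
    have le: "drawn ?T W \<subseteq> drawn F W" by (auto simp: drawn_def)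
    have fr: "frontier C \<subseteq> drawn ?T W"
    proof
      fix z assume z: "z \<in> frontier C"
      then have "z \<in> drawn F W"
        using frontier_of_components_closed_complement[OF closed_drawn[OF sub]] C by (auto simp: faces_def)
      then consider "z \<in> pos ` W" | e where "e \<in> F" "z \<in> path_image (\<gamma> e)" "z \<notin> pos ` W" by (auto simp: drawn_def)
      then show "z \<in> drawn ?T W"
      proof cases
        case 2
        then have "z \<in> edge_interior e" using F(2) by (auto simp: edge_interior_def)
        then have "touches C e" using z by (auto simp: touches_def frontier_def)
        then show ?thesis using 2 by (auto simp: drawn_def)
      qed (auto simp: drawn_def)
    qed
    have "- drawn ?T W - C = {}"
    proof (rule ccontr)
      assume "- drawn ?T W - C \<noteq> {}"
      moreover have "C \<noteq> {}" using C in_components_nonempty unfolding faces_def by blast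
      then have "- drawn ?T W \<inter> C \<noteq> {}" using Csub le by blast
      ultimately show False using connected_Int_frontier[OF conn] fr by blast
    qed
    then have eq: "drawn F W \<subseteq> drawn ?T W" using Csub by blast
    have "F \<subseteq> ?T"
    proof
      fix e assume e: "e \<in> F"
      have eE: "e \<in> \<E>" using F e by auto
      show "e \<in> ?T"
      proof (rule ccontr)
        assume "e \<notin> ?T"
        then have "edge_interior e \<inter> drawn ?T W = {}" using edge_interior_disjoint[OF subT eE] by blast
        moreover have "edge_interior e \<subseteq> drawn F W" using e by (auto simp: edge_interior_def drawn_def)
        ultimately show False using eq edge_interior_nonempty[OF eE] by blast
      qed
    qed
    then have "?T = F" by blast
    then show False using leafy nl by simp
  qed
  have "\<exists>vs. cycle_in ?T vs"
    by (rule not_leafy_cycle[OF subgraph_ofD(4)[OF subT] _ \<open>\<not> leafy ?T\<close>]) (use edge_pair F(1) in auto)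
  then obtain vs where vs: "cycle_in ?T vs" ..
  then have "cycle_in \<E> vs"
    using F(1) by (auto intro: cycle_in_mono)
  then show ?thesis using girth cycle_in_card[OF vs] F(4) by fastforce
qed

section \<open>Jordan curves along cycles and the Euler inequality\<close>

lemma oriented_edge:
  assumes "{u, v} \<in> \<E>"
  shows "\<exists>g. arc g \<and> pathstart g = pos u \<and> pathfinish g = pos v \<and> path_image g = path_image (\<gamma> {u, v})"
proof -
  have "{pathstart (\<gamma> {u, v}), pathfinish (\<gamma> {u, v})} = {pos u, pos v}" using edge_ends[OF assms] by simp
  then consider "pathstart (\<gamma> {u, v}) = pos u" "pathfinish (\<gamma> {u, v}) = pos v"
    | "pathstart (\<gamma> {u, v}) = pos v" "pathfinish (\<gamma> {u, v}) = pos u" by (auto simp: doubleton_eq_iff)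
  then show ?thesis
  proof cases
    case 1
    then show ?thesis using arc_edge[OF assms] by blast
  next
    case 2
    then show ?thesis
      using arc_edge[OF assms] by (intro exI[of _ "reversepath (\<gamma> {u, v})"]) (auto simp: arc_reversepath)
  qed
qed

lemma path_arc:
  assumes "distinct vs" "2 \<le> length vs" "path_edges vs \<subseteq> \<E>"
  shows "\<exists>g. arc g \<and> pathstart g = pos (hd vs) \<and> pathfinish g = pos (last vs) \<and>
    path_image g = (\<Union>e\<in>path_edges vs. path_image (\<gamma> e))"
  using assms
proof (induction vs rule: path_edges.induct)
  case (1 u v r)
  have uv: "{u, v} \<in> \<E>" using 1 by auto
  obtain g1 where g1: "arc g1" "pathstart g1 = pos u" "pathfinish g1 = pos v" "path_image g1 = path_image (\<gamma> {u, v})"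
    using oriented_edge[OF uv] by blast
  show ?case
  proof (cases "r = []")
    case True
    then show ?thesis using g1 by (intro exI[of _ g1]) auto
  next
    case False
    then obtain g2 where g2: "arc g2" "pathstart g2 = pos v" "pathfinish g2 = pos (last (v # r))"
        "path_image g2 = (\<Union>e\<in>path_edges (v # r). path_image (\<gamma> e))"
      using 1 by (cases r) auto
    have "path_image g1 \<inter> path_image g2 \<subseteq> {pos v}"
    proof
      fix z assume "z \<in> path_image g1 \<inter> path_image g2"
      then obtain f where f: "f \<in> path_edges (v # r)" "z \<in> path_image (\<gamma> f)" "z \<in> path_image (\<gamma> {u, v})"
        unfolding g1(4) g2(4) by blast
      have "u \<notin> f" using path_edges_subset[OF f(1)] 1(2) by auto
      then have "{u, v} \<noteq> f" by auto
      then have "z \<in> pos ` ({u, v} \<inter> f)" using edge_inter[OF uv, of f] f 1(4) by auto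
      then show "z \<in> {pos v}" using \<open>u \<notin> f\<close> by auto
    qed
    then have "arc (g1 +++ g2)" using g1 g2 by (intro arc_join) auto
    then show ?thesis
      using g1 g2 by (intro exI[of _ "g1 +++ g2"]) (auto simp: path_image_join)
  qed
qed auto

lemma cycle_curve:
  assumes "cycle_in F vs" "F \<subseteq> \<E>"
  shows "\<exists>c. simple_path c \<and> pathfinish c = pathstart c \<and>
    path_image (\<gamma> {last vs, hd vs}) \<subseteq> path_image c \<and> path_image c \<subseteq> (\<Union>e\<in>F. path_image (\<gamma> e))"
proof -
  let ?e = "{last vs, hd vs}"
  have vs: "distinct vs" "3 \<le> length vs" "path_edges vs \<subseteq> F" "?e \<in> F"
    using assms(1) successively_path_edges by (auto simp: cycle_in_def)
  obtain g where g: "arc g" "pathstart g = pos (hd vs)" "pathfinish g = pos (last vs)"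
      "path_image g = (\<Union>e\<in>path_edges vs. path_image (\<gamma> e))"
    using path_arc[of vs] vs assms(2) by auto
  obtain h where h: "arc h" "pathstart h = pos (last vs)" "pathfinish h = pos (hd vs)" "path_image h = path_image (\<gamma> ?e)"
    using oriented_edge[of "last vs" "hd vs"] vs(4) assms(2) by blast
  have "path_image g \<inter> path_image h \<subseteq> {pathstart g, pathstart h}"
  proof
    fix z assume "z \<in> path_image g \<inter> path_image h"
    then obtain f where f: "f \<in> path_edges vs" "z \<in> path_image (\<gamma> f)" "z \<in> path_image (\<gamma> ?e)"
      unfolding g(4) h(4) by blast
    have "?e \<noteq> f" using closing_edge_notin_path_edges[OF vs(1,2)] f(1) by auto
    then have "z \<in> pos ` (?e \<inter> f)" using edge_inter[of ?e f] f vs assms(2) by auto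
    then show "z \<in> {pathstart g, pathstart h}" using g h by auto
  qed
  then have "simple_path (g +++ h)" using g h by (intro simple_path_join_loop) auto
  moreover have "path_image (g +++ h) = path_image g \<union> path_image h" using g h by (intro path_image_join) auto
  ultimately show ?thesis using g h vs by (intro exI[of _ "g +++ h"]) auto
qed

text \<open>The map \<open>up\<close> sends a face to the face that contains it after the deletion.
  It is onto, but not injective: two faces on different sides of a Jordan curve through the edge
  both go to \<open>X\<close>.\<close>

lemma cycle_edge_splits_face:
  assumes sub: "subgraph_of F W" and cyc: "cycle_in F vs" and fin: "finite (faces F W)"
  shows "card (faces (F - {{last vs, hd vs}}) W) < card (faces F W)"
proof -
  define e where "e = {last vs, hd vs}"
  have e: "e \<in> F" using cyc by (simp add: cycle_in_def e_def)
  note F = subgraph_ofD[OF sub]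
  have eE: "e \<in> \<E>" using F e by auto
  obtain c where c': "simple_path c" "pathfinish c = pathstart c" "path_image (\<gamma> e) \<subseteq> path_image c"
    "path_image c \<subseteq> (\<Union>e\<in>F. path_image (\<gamma> e))"
    using cycle_curve[OF cyc F(1)] unfolding e_def by blast
  have c: "simple_path c" "pathfinish c = pathstart c" "path_image (\<gamma> e) \<subseteq> path_image c"
    "path_image c \<subseteq> drawn F W"
    using c' by (auto simp: drawn_def)
  define J where "J = path_image c"
  define K where "K = drawn (F - {e}) W"
  have subK: "subgraph_of (F - {e}) W" using subgraph_of_mono[OF sub] by auto
  have dr: "drawn F W = K \<union> edge_interior e" using drawn_remove_edge(2)[OF sub e] by (simp add: K_def)
  have disj: "edge_interior e \<subseteq> - K" using edge_interior_disjoint[OF subK eE] by (auto simp: K_def)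
  obtain z where z: "z \<in> edge_interior e" using edge_interior_nonempty[OF eE] by blast
  define X where "X = connected_component_set (- K) z"
  have X: "open X" "edge_interior e \<subseteq> X" "X \<subseteq> - K" "X \<in> components (- K)"
    using closed_drawn[OF subK] connected_component_maximal[OF z connected_edge_interior[OF eE] disj]
      connected_component_subset z disj
    by (auto simp: X_def K_def open_connected_component open_Compl componentsI)
  have eJ: "edge_interior e \<subseteq> J" using c(3) by (auto simp: edge_interior_def J_def)
  have jordan: "frontier (inside J) = J" "frontier (outside J) = J" "inside J \<inter> outside J = {}" "inside J \<inter> J = {}" "outside J \<inter> J = {}"
    using Jordan_inside_outside[OF c(1,2)] inside_no_overlap outside_no_overlap by (auto simp: J_def)
  have zJ: "z \<in> J" using z eJ by auto
  \<comment> \<open>The point \<open>z\<close> of the open edge is on the frontier of both the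
    inside and the outside of \<open>J\<close>, so the open set \<open>X\<close> contains points of
    both.\<close>
  have meet: "\<exists>y. y \<in> X \<inter> S" if "frontier S = J" for S
  proof -
    have "z \<in> closure S" using zJ that by (auto simp: frontier_def)
    then show ?thesis using open_Int_closure_eq_empty[OF X(1), of S] z X(2) by blast
  qed
  obtain y1 where y1: "y1 \<in> X" "y1 \<in> inside J" using meet[OF jordan(1)] by blast
  obtain y2 where y2: "y2 \<in> X" "y2 \<in> outside J" using meet[OF jordan(2)] by blast
  define comp where "comp y = connected_component_set (- drawn F W) y" for y
  have compI: "comp y \<in> faces F W" "y \<in> comp y" if "y \<in> - K" "y \<notin> edge_interior e" for y
    using that by (auto simp: comp_def faces_def dr componentsI)
  have y1': "y1 \<in> - K" "y1 \<notin> edge_interior e" and y2': "y2 \<in> - K" "y2 \<notin> edge_interior e"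
    using y1 y2 X(3) eJ jordan(4,5) by blast+
  have ne: "comp y1 \<noteq> comp y2"
  proof
    assume eq: "comp y1 = comp y2"
    have "connected (comp y1)" by (simp add: comp_def)
    moreover have "comp y1 \<inter> inside J \<noteq> {}" using compI(2)[OF y1'] y1 by blast
    moreover have "comp y1 - inside J \<noteq> {}" using compI(2)[OF y2'] y2 jordan(3) eq by blast
    ultimately have "comp y1 \<inter> J \<noteq> {}" using connected_Int_frontier jordan(1) by metis
    moreover have "comp y1 \<subseteq> - drawn F W" by (simp add: comp_def connected_component_subset)
    ultimately show False using c(4) by (auto simp: J_def)
  qed
  define up where "up C = (SOME D. D \<in> faces (F - {e}) W \<and> C \<subseteq> D)" for C
  have up: "up C = D" if "C \<in> faces F W" "D \<in> faces (F - {e}) W" "C \<inter> D \<noteq> {}" for C D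
  proof -
    have "connected C" "C \<subseteq> - K"
      using that(1) in_components_connected in_components_subset dr by (fastforce simp: faces_def)+
    then have CD: "C \<subseteq> D" using components_maximal[of D "- K" C] that by (auto simp: faces_def K_def)
    have uniq: "D' = D" if "D' \<in> faces (F - {e}) W" "C \<subseteq> D'" for D'
      using components_nonoverlap[of D' "- K" D] that CD \<open>D \<in> faces (F - {e}) W\<close> \<open>C \<inter> D \<noteq> {}\<close>
      by (auto simp: faces_def K_def)
    show ?thesis unfolding up_def by (rule some_equality) (use CD that(2) uniq in blast)+
  qed
  have XK: "X \<in> faces (F - {e}) W" using X(4) by (simp add: faces_def K_def)
  have "faces (F - {e}) W \<subseteq> up ` faces F W"
  proof
    fix D assume D: "D \<in> faces (F - {e}) W"
    have "\<exists>y \<in> D. y \<in> - K \<and> y \<notin> edge_interior e"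
    proof (cases "D = X")
      case True
      then show ?thesis using y1 y1' by blast
    next
      case False
      then have "D \<inter> X = {}" using components_nonoverlap[of D "- K" X] D X(4) by (auto simp: faces_def K_def)
      moreover have "D \<noteq> {}" "D \<subseteq> - K" using D in_components_nonempty[of D "- K"] in_components_subset[of D "- K"] by (simp_all add: faces_def K_def)
      ultimately show ?thesis using X(2) by blast
    qed
    then obtain y where y: "y \<in> D" "y \<in> - K" "y \<notin> edge_interior e" by blast
    then have "up (comp y) = D" using up[OF compI(1) D] compI(2) by blast
    then show "D \<in> up ` faces F W" using compI(1)[OF y(2,3)] by blast
  qed
  then have le: "card (faces (F - {e}) W) \<le> card (up ` faces F W)" using fin by (intro card_mono) auto
  have "\<not> inj_on up (faces F W)"
  proof
    assume "inj_on up (faces F W)"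
    moreover have "up (comp y1) = X" using up[OF compI(1)[OF y1'] XK] compI(2)[OF y1'] y1 by blast
    moreover have "up (comp y2) = X" using up[OF compI(1)[OF y2'] XK] compI(2)[OF y2'] y2 by blast
    ultimately show False using ne compI(1)[OF y1'] compI(1)[OF y2'] by (metis inj_onD)
  qed
  then have "card (up ` faces F W) < card (faces F W)"
    using fin card_image_le[OF fin, of up] eq_card_imp_inj_on[OF fin, of up] by linarith
  then show ?thesis using le by (simp add: e_def)
qed

lemma finite_faces:
  assumes "subgraph_of F W"
  shows "finite (faces F W)"
proof (cases "leafy F")
  case True
  have "finite (components S)" if "connected S" for S :: "complex set"
    using that components_eq_sing_iff[of S] by (cases "S = {}") auto
  then show ?thesis using leafy_connected_complement[OF True assms] by (simp add: faces_def)
next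
  case False
  have "faces F W \<subseteq> (\<Union>e\<in>F. {C \<in> faces F W. touches C e})"
  proof
    fix C assume C: "C \<in> faces F W"
    have "card {e \<in> F. touches C e} \<noteq> 0" using face_touches_many[OF assms False C] by linarith
    then have "{e \<in> F. touches C e} \<noteq> {}" by (metis card.empty)
    then show "C \<in> (\<Union>e\<in>F. {C \<in> faces F W. touches C e})" using C by blast
  qed
  moreover have "finite (\<Union>e\<in>F. {C \<in> faces F W. touches C e})"
    using two_faces_per_edge[OF assms] subgraph_ofD(4)[OF assms] by blast
  ultimately show ?thesis using finite_subset by blast
qed

text \<open>The half of Euler's formula that survives for disconnected graphs. Deleting an edge of a
  cycle costs one edge and at least one face; the forest that remains has one face and fewer edges
  than vertices.\<close>

lemma many_faces:
  assumes "subgraph_of F W" "W \<noteq> {}"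
  shows "card F + 2 \<le> card (faces F W) + card W"
  using assms
proof (induction "card F" arbitrary: F rule: less_induct)
  case less
  note F = subgraph_ofD[OF less.prems(1)]
  show ?case
  proof (cases "leafy F")
    case True
    have "card F < card W"
      by (rule leafy_card[OF F(4) True _ F(2,5) less.prems(2)]) (use edge_pair F(1) in auto)
    moreover have "- drawn F W \<noteq> {}"
      using compact_imp_bounded[OF compact_drawn[OF less.prems(1)]] not_bounded_UNIV by (metis double_compl Compl_empty_eq)
    then have "faces F W = {- drawn F W}"
      unfolding faces_def components_eq_sing_iff using leafy_connected_complement[OF True less.prems(1)] by simp
    ultimately show ?thesis by simp
  next
    case False
    have "\<exists>vs. cycle_in F vs"
      by (rule not_leafy_cycle[OF F(4) _ False]) (use edge_pair F(1) in auto)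
    then obtain vs where vs: "cycle_in F vs" ..
    let ?e = "{last vs, hd vs}"
    have e: "?e \<in> F" using vs by (simp add: cycle_in_def)
    have c: "card F = Suc (card (F - {?e}))" using card.remove[OF F(4) e] by simp
    have "card (F - {?e}) + 2 \<le> card (faces (F - {?e}) W) + card W"
      by (rule less.hyps) (use c subgraph_of_mono[OF less.prems(1)] less.prems(2) in auto)
    then show ?thesis
      using c cycle_edge_splits_face[OF less.prems(1) vs finite_faces[OF less.prems(1)]] by linarith
  qed
qed

text \<open>Counting touching pairs gives \<open>10 f \<le> 2 m\<close>; with
  \<open>m + 2 \<le> f + n\<close> this yields \<open>4 m + 10 \<le> 5 n\<close>. A forest is
  treated apart because its only face may touch fewer than 10 edges.\<close>

theorem sparse:
  assumes "subgraph_of F W" "W \<noteq> {}"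
  shows "4 * card F < 5 * card W"
proof (cases "leafy F")
  case True
  note F = subgraph_ofD[OF assms(1)]
  have "card F < card W"
    by (rule leafy_card[OF F(4) True _ F(2,5) assms(2)]) (use edge_pair F(1) in auto)
  then show ?thesis by linarith
next
  case False
  note F = subgraph_ofD[OF assms(1)]
  have fin: "finite (faces F W)" by (rule finite_faces[OF assms(1)])
  have "10 * card (faces F W) = (\<Sum>C\<in>faces F W. 10)" by simp
  also have "\<dots> \<le> (\<Sum>C\<in>faces F W. card {e \<in> F. touches C e})"
    using face_touches_many[OF assms(1) False] by (intro sum_mono)
  also have "\<dots> = (\<Sum>C\<in>faces F W. \<Sum>e\<in>F. of_bool (touches C e))" using F(4) by (simp add: Int_def)
  also have "\<dots> = (\<Sum>e\<in>F. \<Sum>C\<in>faces F W. of_bool (touches C e))" by (rule sum.swap)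
  also have "\<dots> = (\<Sum>e\<in>F. card {C \<in> faces F W. touches C e})" using fin by (simp add: Int_def)
  also have "\<dots> \<le> (\<Sum>e\<in>F. 2)" using two_faces_per_edge[OF assms(1)] by (intro sum_mono) blast
  finally have "10 * card (faces F W) \<le> 2 * card F" by simp
  then show ?thesis using many_faces[OF assms] by linarith
qed

end

section \<open>Recoloring trees\<close>

definition has_odd_count :: "'c list \<Rightarrow> bool" where
  "has_odd_count xs \<longleftrightarrow> (\<exists>k. odd (count_list xs k))"

lemma has_odd_count_odd_length:
  assumes "odd (length xs)"
  shows "has_odd_count xs"
proof (rule ccontr)
  assume "\<not> ?thesis"
  then have "even (\<Sum>k\<in>set xs. count_list xs k)"
    by (auto simp: has_odd_count_def intro!: dvd_sum)
  then show False using assms by (simp add: sum_count_set)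
qed

text \<open>Replacing \<open>b\<close> by \<open>b'\<close> flips the parity of the count of
  \<open>b\<close>.\<close>

lemma has_odd_count_two_choices:
  assumes "b \<noteq> b'"
  shows "has_odd_count (xs @ b # ys) \<or> has_odd_count (xs @ b' # ys)"
proof (cases "odd (count_list (xs @ b # ys) b)")
  case False
  then have "odd (count_list (xs @ b' # ys) b)" using assms by simp
  then show ?thesis unfolding has_odd_count_def by blast
qed (auto simp: has_odd_count_def)

lemma has_odd_count_pair [simp]: "has_odd_count [a, b] \<longleftrightarrow> a \<noteq> b"
  unfolding has_odd_count_def by (cases "a = b") (auto intro: exI[of _ a])

lemma card_eq_count_list:
  assumes "distinct us"
  shows "card {u \<in> set us. c u = k} = count_list (map c us) k"
  using assms
proof (induction us)
  case (Cons u us)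
  have "{w \<in> set (u # us). c w = k} = (if c u = k then {u} else {}) \<union> {w \<in> set us. c w = k}" by auto
  then show ?case using Cons by auto
qed simp

text \<open>A rooted tree of vertices to be recolored (\<open>Node\<close>), whose leaves \<open>Ext\<close> keep their color.\<close>

datatype 'a rtree = Ext 'a | Node 'a "'a rtree list"

fun root_of :: "'a rtree \<Rightarrow> 'a" where
  "root_of (Ext y) = y"
| "root_of (Node v ts) = v"

fun tverts :: "'a rtree \<Rightarrow> 'a list" where
  "tverts (Ext y) = [y]"
| "tverts (Node v ts) = v # concat (map tverts ts)"

fun inner_of :: "'a rtree \<Rightarrow> 'a set" where
  "inner_of (Ext y) = {}"
| "inner_of (Node v ts) = insert v (\<Union>t\<in>set ts. inner_of t)"

fun ext_arcs :: "'a \<Rightarrow> 'a rtree \<Rightarrow> ('a \<times> 'a) set" where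
  "ext_arcs p (Ext y) = {(p, y)}"
| "ext_arcs p (Node v ts) = (\<Union>t\<in>set ts. ext_arcs v t)"

text \<open>Counts vertices, kept leaves included: two trees of heights \<open>h\<close> and
  \<open>k\<close> below a common parent are joined by walks with at most \<open>h + k + 1\<close>
  vertices.\<close>

fun height :: "'a rtree \<Rightarrow> nat" where
  "height (Ext y) = 1"
| "height (Node v ts) = Suc (foldr max (map height ts) 0)"

lemma foldr_max_ge: "x \<in> set xs \<Longrightarrow> x \<le> foldr max xs (0::nat)"
  by (induction xs) auto

lemma root_in_tverts: "root_of t \<in> set (tverts t)"
  by (cases t) auto

lemma Ext_if_root_notin_inner: "root_of t \<notin> inner_of t \<Longrightarrow> t = Ext (root_of t)"
  by (cases t) auto

lemma ext_arcs_in_tverts: "(s, y) \<in> ext_arcs p t \<Longrightarrow> y \<in> set (tverts t)"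
  by (induction t arbitrary: p) auto

lemma distinct_concat_map_unique:
  "\<lbrakk>distinct (concat (map f ts)); t \<in> set ts; t' \<in> set ts; w \<in> set (f t); w \<in> set (f t')\<rbrakk> \<Longrightarrow> t = t'"
  by (induction ts) auto

lemma ext_arcs_unique:
  "\<lbrakk>(s, y) \<in> ext_arcs p t; (s', y) \<in> ext_arcs p t; distinct (tverts t)\<rbrakk> \<Longrightarrow> s = s'"
proof (induction t arbitrary: p)
  case (Node v ts)
  then obtain t t' where t: "t \<in> set ts" "(s, y) \<in> ext_arcs v t" "t' \<in> set ts" "(s', y) \<in> ext_arcs v t'"
    by auto
  have d: "distinct (concat (map tverts ts))" using Node.prems by simp
  have "t = t'"
    using distinct_concat_map_unique[OF d] t ext_arcs_in_tverts by fast
  moreover have "distinct (tverts t)" using d t by (auto simp: distinct_concat_iff)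
  ultimately show ?case using Node.IH[OF t(1)] t by blast
qed auto

text \<open>\<open>feasible c0 ob t \<alpha> \<beta>\<close>: with color \<open>\<alpha>\<close> at the parent and \<open>\<beta>\<close> at the root, \<open>t\<close> can be colored
  so that all inner vertices are satisfied; \<open>ob y\<close> is the one color that would spoil the leaf \<open>y\<close>.\<close>

fun feasible :: "('a \<Rightarrow> nat) \<Rightarrow> ('a \<Rightarrow> nat) \<Rightarrow> 'a rtree \<Rightarrow> nat \<Rightarrow> nat \<Rightarrow> bool" where
  "feasible c0 ob (Ext y) \<alpha> \<beta> = (\<beta> = c0 y \<and> \<alpha> \<noteq> \<beta> \<and> \<alpha> \<noteq> ob y)"
| "feasible c0 ob (Node v ts) \<alpha> \<beta> = (\<beta> < 4 \<and> \<alpha> \<noteq> \<beta> \<and>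
     (\<exists>b. (\<forall>t\<in>set ts. feasible c0 ob t \<beta> (b t)) \<and> has_odd_count (\<alpha> # map b ts)))"

fun valid :: "('a \<Rightarrow> nat) \<Rightarrow> ('a \<Rightarrow> nat) \<Rightarrow> ('a \<Rightarrow> nat) \<Rightarrow> 'a \<Rightarrow> 'a rtree \<Rightarrow> bool" where
  "valid c0 ob g p (Ext y) = (g y = c0 y \<and> g p \<noteq> g y \<and> g p \<noteq> ob y)"
| "valid c0 ob g p (Node v ts) = (g v < 4 \<and> g p \<noteq> g v \<and> has_odd_count (g p # map (\<lambda>t. g (root_of t)) ts) \<and>
     (\<forall>t\<in>set ts. valid c0 ob g v t))"

lemma valid_ext_arcs:
  "valid c0 ob g p t \<Longrightarrow> (s, y) \<in> ext_arcs p t \<Longrightarrow> g y = c0 y \<and> g s \<noteq> g y \<and> g s \<noteq> ob y"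
  by (induction t arbitrary: p) auto

lemma merge_on_disjoint:
  assumes "distinct (concat (map tverts ts))" "\<And>t. t \<in> set ts \<Longrightarrow> h t (root_of t) = b t"
  shows "\<exists>H. \<forall>t\<in>set ts. H (root_of t) = b t \<and> (\<forall>w\<in>set (tverts t). H w = h t w)"
proof -
  define H where "H w = h (SOME t. t \<in> set ts \<and> w \<in> set (tverts t)) w" for w
  have H: "H w = h t w" if "t \<in> set ts" "w \<in> set (tverts t)" for t w
  proof -
    have "(SOME t. t \<in> set ts \<and> w \<in> set (tverts t)) = t"
      by (rule some_equality) (use that distinct_concat_map_unique[OF assms(1)] in auto)
    then show ?thesis by (simp add: H_def)
  qed
  show ?thesis by (intro exI[of _ H]) (auto simp: H assms(2) root_in_tverts)
qed

text \<open>Disjoint subtrees are colored independently and merged. Validity is claimed for every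
  \<open>g\<close> that extends \<open>h\<close>, since the rest of the graph is fixed only
  later.\<close>

lemma feasible_imp_valid:
  assumes "feasible c0 ob t \<alpha> \<beta>" "distinct (tverts t)"
  shows "\<exists>h. h (root_of t) = \<beta> \<and> (\<forall>g p. g p = \<alpha> \<longrightarrow> (\<forall>w\<in>set (tverts t). g w = h w) \<longrightarrow> valid c0 ob g p t)"
  using assms
proof (induction t arbitrary: \<alpha> \<beta>)
  case (Ext y)
  then show ?case by (intro exI[of _ "\<lambda>_. \<beta>"]) auto
next
  case (Node v ts)
  from Node.prems(1) obtain b where b: "\<beta> < 4" "\<alpha> \<noteq> \<beta>" "\<And>t. t\<in>set ts \<Longrightarrow> feasible c0 ob t \<beta> (b t)" "has_odd_count (\<alpha> # map b ts)"
    unfolding feasible.simps by blast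
  have d: "distinct (concat (map tverts ts))" "v \<notin> set (concat (map tverts ts))" using Node.prems by auto
  have "\<forall>t\<in>set ts. \<exists>h. h (root_of t) = b t \<and> (\<forall>g p. g p = \<beta> \<longrightarrow> (\<forall>w\<in>set (tverts t). g w = h w) \<longrightarrow> valid c0 ob g p t)"
    using Node.IH b(3) d by (auto simp: distinct_concat_iff)
  then obtain h where h: "\<And>t. t \<in> set ts \<Longrightarrow> h t (root_of t) = b t"
    "\<And>t g p. t \<in> set ts \<Longrightarrow> g p = \<beta> \<Longrightarrow> (\<forall>w\<in>set (tverts t). g w = h t w) \<Longrightarrow> valid c0 ob g p t"
    by metis
  obtain H where H: "\<And>t. t\<in>set ts \<Longrightarrow> H (root_of t) = b t" "\<And>t w. t\<in>set ts \<Longrightarrow> w\<in>set (tverts t) \<Longrightarrow> H w = h t w"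
    using merge_on_disjoint[of ts h b, OF d(1) h(1)] by blast
  show ?case
  proof (intro exI[of _ "H(v := \<beta>)"] conjI allI impI)
    fix g p assume g: "g p = \<alpha>" "\<forall>w\<in>set (tverts (Node v ts)). g w = (H(v := \<beta>)) w"
    have gv: "g v = \<beta>" using g by simp
    have gt: "g w = H w" if "t \<in> set ts" "w \<in> set (tverts t)" for t w
      using g(2) d(2) that by (auto split: if_splits)
    have "map (\<lambda>t. g (root_of t)) ts = map b ts"
      by (intro map_cong refl) (use gt root_in_tverts H(1) in metis)
    moreover have "valid c0 ob g v t" if "t \<in> set ts" for t
      using h(2)[of t g v] gv gt H that by auto
    ultimately show "valid c0 ob g p (Node v ts)" using b g(1) gv by (simp del: map_eq_conv)
  qed simp
qed

definition passable :: "('a \<Rightarrow> nat) \<Rightarrow> ('a \<Rightarrow> nat) \<Rightarrow> 'a rtree \<Rightarrow> nat \<Rightarrow> bool" where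
  "passable c0 ob t \<alpha> \<longleftrightarrow> (\<exists>\<beta>. feasible c0 ob t \<alpha> \<beta>)"

definition flexible :: "('a \<Rightarrow> nat) \<Rightarrow> ('a \<Rightarrow> nat) \<Rightarrow> 'a rtree \<Rightarrow> nat \<Rightarrow> bool" where
  "flexible c0 ob t \<alpha> \<longleftrightarrow> (\<exists>\<beta> \<beta>'. \<beta> \<noteq> \<beta>' \<and> feasible c0 ob t \<alpha> \<beta> \<and> feasible c0 ob t \<alpha> \<beta>')"

text \<open>\<open>cs\<close> holds the color of the parent, or nothing at the root of the whole
  configuration. An odd number of neighbours needs no care; otherwise one flexible child adjusts the
  parity.\<close>

lemma choose_children:
  assumes "\<And>t. t \<in> set ts \<Longrightarrow> passable c0 ob t \<alpha>" "distinct ts"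
    and "odd (length cs + length ts) \<or> (\<exists>t\<in>set ts. flexible c0 ob t \<alpha>)"
  shows "\<exists>b. (\<forall>t\<in>set ts. feasible c0 ob t \<alpha> (b t)) \<and> has_odd_count (cs @ map b ts)"
proof -
  obtain b where b: "\<And>t. t \<in> set ts \<Longrightarrow> feasible c0 ob t \<alpha> (b t)"
    using assms(1) unfolding passable_def by metis
  from assms(3) show ?thesis
  proof
    assume "odd (length cs + length ts)"
    then show ?thesis using b has_odd_count_odd_length[of "cs @ map b ts"] by auto
  next
    assume "\<exists>t\<in>set ts. flexible c0 ob t \<alpha>"
    then obtain t \<beta> \<beta>' where t: "t \<in> set ts" "\<beta> \<noteq> \<beta>'" "feasible c0 ob t \<alpha> \<beta>" "feasible c0 ob t \<alpha> \<beta>'"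
      unfolding flexible_def by blast
    obtain xs ys where xy: "ts = xs @ t # ys" using t(1) by (meson split_list)
    have ne: "t \<notin> set xs" "t \<notin> set ys" using assms(2) xy by auto
    have m: "cs @ map (b(t := z)) ts = (cs @ map b xs) @ z # map b ys" for z
      using ne xy by auto
    have "has_odd_count (cs @ map (b(t := \<beta>)) ts) \<or> has_odd_count (cs @ map (b(t := \<beta>')) ts)"
      unfolding m by (rule has_odd_count_two_choices[OF t(2)])
    then obtain z where "has_odd_count (cs @ map (b(t := z)) ts)" "feasible c0 ob t \<alpha> z"
      using t by blast
    then show ?thesis using b by (intro exI[of _ "b(t := z)"]) auto
  qed
qed

text \<open>A 2-vertex is satisfied exactly if its neighbours have different colors, here \<alpha>
  and \<open>b\<close>.\<close>

lemma feasible_chain: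
  "feasible c0 ob (Node u [t]) \<alpha> \<beta> \<longleftrightarrow> \<beta> < 4 \<and> \<alpha> \<noteq> \<beta> \<and> (\<exists>b. feasible c0 ob t \<beta> b \<and> \<alpha> \<noteq> b)"
proof
  assume "\<beta> < 4 \<and> \<alpha> \<noteq> \<beta> \<and> (\<exists>b. feasible c0 ob t \<beta> b \<and> \<alpha> \<noteq> b)"
  then obtain b where "\<beta> < 4" "\<alpha> \<noteq> \<beta>" "feasible c0 ob t \<beta> b" "\<alpha> \<noteq> b" by blast
  then show "feasible c0 ob (Node u [t]) \<alpha> \<beta>" by (auto intro!: exI[of _ "\<lambda>_. b"])
qed auto

lemma foldr_max_le: "(\<And>y. y \<in> set ys \<Longrightarrow> y \<le> k) \<Longrightarrow> foldr max ys 0 \<le> (k::nat)"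
  by (induction ys) auto

lemma sorted_wrt_distinct:
  assumes "distinct xs" "\<And>x y. \<lbrakk>x \<in> set xs; y \<in> set xs; x \<noteq> y\<rbrakk> \<Longrightarrow> P x y"
  shows "sorted_wrt P xs"
  using assms by (induction xs) auto

section \<open>Reducible configurations\<close>

text \<open>Recoloring and discharging see only this condition on cycles; planarity returns as the
  density bound in \<open>odd_colorable4_if_sparse\<close>.\<close>

locale girth10_graph =
  fixes E :: "'a \<Rightarrow> 'a \<Rightarrow> bool"
  assumes E_sym: "E u v \<Longrightarrow> E v u" and E_irrefl: "\<not> E v v"
    and long_cycles: "\<lbrakk>distinct vs; 3 \<le> length vs; successively E vs; E (last vs) (hd vs)\<rbrakk> \<Longrightarrow> 10 \<le> length vs"
begin

section \<open>Nonbacktracking walks and disjointness of trees\<close>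

fun nonbacktracking :: "'a list \<Rightarrow> bool" where
  "nonbacktracking [] = True"
| "nonbacktracking [x] = True"
| "nonbacktracking [x, y] = E x y"
| "nonbacktracking (x # y # z # r) = (E x y \<and> x \<noteq> z \<and> nonbacktracking (y # z # r))"

lemma nonbacktracking_Cons:
  "nonbacktracking (x # ys) \<longleftrightarrow> nonbacktracking ys \<and> (ys \<noteq> [] \<longrightarrow> E x (hd ys)) \<and>
     (\<forall>y z r. ys = y # z # r \<longrightarrow> x \<noteq> z)"
  by (cases ys rule: nonbacktracking.cases) auto

lemma nonbacktracking_successively: "nonbacktracking ws \<Longrightarrow> successively E ws"
  by (induction ws rule: nonbacktracking.induct) auto

text \<open>A repetition of the first vertex after one or two steps is a loop or a backtrack; a
  later one closes a cycle on at most 9 vertices.\<close>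

lemma nonbacktracking_distinct:
  assumes "nonbacktracking ws" "length ws \<le> 10"
  shows "distinct ws"
  using assms
proof (induction ws)
  case (Cons x r)
  then have r: "distinct r" by (simp add: nonbacktracking_Cons)
  show ?case
  proof (cases "x \<in> set r")
    case True
    then obtain A B where AB: "r = A @ x # B" by (meson split_list)
    have suc: "successively E (x # A @ x # B)"
      using nonbacktracking_successively[OF Cons.prems(1)] AB by simp
    have "\<not> length A < 2"
    proof
      assume "length A < 2"
      then consider "A = []" | a where "A = [a]" by (cases A) auto
      then show False
        using Cons.prems(1) AB E_irrefl by cases (auto simp: nonbacktracking_Cons)
    qed
    then have "A \<noteq> []" by auto
    moreover have "successively E (x # A)" "E (last A) x"
      using suc \<open>A \<noteq> []\<close> by (auto simp: successively_append_iff successively_Cons)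
    ultimately have "10 \<le> length (x # A)"
      using r AB \<open>\<not> length A < 2\<close> by (intro long_cycles) auto
    then show ?thesis using Cons.prems(2) AB by simp
  qed (use r in simp)
qed simp

lemma nonbacktracking_join:
  assumes "nonbacktracking (a # as)" "nonbacktracking (b # bs)" "E a b"
    "as \<noteq> [] \<longrightarrow> hd as \<noteq> b" "bs \<noteq> [] \<longrightarrow> a \<noteq> hd bs"
  shows "nonbacktracking (rev (a # as) @ b # bs)"
  using assms
proof (induction as arbitrary: a b bs)
  case Nil
  then show ?case by (cases bs) auto
next
  case (Cons a' as)
  have "nonbacktracking (a # b # bs)" using Cons.prems by (auto simp: nonbacktracking_Cons)
  moreover have "nonbacktracking (a' # as)" "E a' a" "as \<noteq> [] \<longrightarrow> hd as \<noteq> a"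
    using Cons.prems(1) E_sym by (auto simp: nonbacktracking_Cons neq_Nil_conv)
  ultimately have "nonbacktracking (rev (a' # as) @ a # b # bs)"
    using Cons.IH[of a' a "b # bs"] Cons.prems by auto
  then show ?case by simp
qed

lemma nonbacktracking_fork:
  assumes "nonbacktracking (v # ws)" "nonbacktracking (v # ws')" "ws \<noteq> []" "ws' \<noteq> []" "hd ws \<noteq> hd ws'"
  shows "nonbacktracking (rev ws @ v # ws')"
proof -
  obtain a as where ws: "ws = a # as" using assms(3) by (cases ws) auto
  have "E v a" "nonbacktracking (a # as)" "as \<noteq> [] \<longrightarrow> hd as \<noteq> v"
    using assms(1) ws by (auto simp: nonbacktracking_Cons neq_Nil_conv)
  then show ?thesis
    using nonbacktracking_join[of a as v ws'] assms ws E_sym by auto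
qed

definition N :: "'a set \<Rightarrow> 'a \<Rightarrow> 'a set" where
  "N W v = {u \<in> W. E v u}"

lemma N_sym: "v \<in> W \<Longrightarrow> u \<in> N W v \<Longrightarrow> v \<in> N W u"
  by (auto simp: N_def E_sym)

definition vertex_ok :: "'a set \<Rightarrow> ('a \<Rightarrow> nat) \<Rightarrow> 'a \<Rightarrow> bool" where
  "vertex_ok W c v \<longleftrightarrow> c v < 4 \<and> (\<forall>u \<in> N W v. c u \<noteq> c v) \<and>
     (N W v = {} \<or> (\<exists>k. odd (card {u \<in> N W v. c u = k})))"

definition odd_colorable4 :: "'a set \<Rightarrow> bool" where
  "odd_colorable4 W \<longleftrightarrow> (\<exists>c. \<forall>v \<in> W. vertex_ok W c v)"

text \<open>Parent and children exhaust \<open>N W v\<close>, so every neighbour of a recolored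
  vertex is under control. \<open>sorted_wrt\<close> imposes the height bound on all pairs of
  subtrees; 9 is the largest sum for which walks through \<open>v\<close> between two of them have
  at most 10 vertices.\<close>

fun tree_in :: "'a set \<Rightarrow> 'a \<Rightarrow> 'a rtree \<Rightarrow> bool" where
  "tree_in W p (Ext y) = (y \<in> N W p)"
| "tree_in W p (Node v ts) = (v \<in> N W p \<and> distinct (p # map root_of ts) \<and> N W v = insert p (root_of ` set ts) \<and>
     sorted_wrt (\<lambda>s t. height s + height t \<le> 9) ts \<and> (\<forall>t\<in>set ts. tree_in W v t))"

lemma tree_walk:
  assumes "tree_in W p t" "w \<in> set (tverts t)"
  shows "\<exists>ws. ws \<noteq> [] \<and> hd ws = root_of t \<and> last ws = w \<and> length ws \<le> height t \<and> nonbacktracking (p # ws)"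
  using assms
proof (induction t arbitrary: p)
  case (Ext y)
  then show ?case by (intro exI[of _ "[y]"]) (auto simp: N_def)
next
  case (Node v ts)
  have E: "E p v" using Node.prems by (auto simp: N_def)
  show ?case
  proof (cases "w = v")
    case True
    then show ?thesis using E by (intro exI[of _ "[v]"]) auto
  next
    case False
    then obtain t where t: "t \<in> set ts" "w \<in> set (tverts t)" using Node.prems by auto
    then obtain ws where ws: "ws \<noteq> []" "hd ws = root_of t" "last ws = w" "length ws \<le> height t" "nonbacktracking (v # ws)"
      using Node.IH[of t v] Node.prems by auto
    have "p \<noteq> root_of t" using Node.prems t by auto
    then have "nonbacktracking (p # v # ws)"
      using ws E by (auto simp: nonbacktracking_Cons)
    moreover have "height t \<le> foldr max (map height ts) 0" using t by (intro foldr_max_ge) auto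
    ultimately show ?thesis using ws by (intro exI[of _ "v # ws"]) auto
  qed
qed

lemma tree_parent_notin:
  assumes "tree_in W p t" "height t \<le> 9"
  shows "p \<notin> set (tverts t)"
proof
  assume "p \<in> set (tverts t)"
  then obtain ws where ws: "ws \<noteq> []" "last ws = p" "length ws \<le> height t" "nonbacktracking (p # ws)"
    using tree_walk[OF assms(1)] by blast
  then have "distinct (p # ws)" using assms(2) by (intro nonbacktracking_distinct) auto
  then show False using ws by auto
qed

lemma trees_disjoint:
  assumes "tree_in W p s" "tree_in W p t" "root_of s \<noteq> root_of t" "height s + height t \<le> 9"
  shows "set (tverts s) \<inter> set (tverts t) = {}"
proof (rule ccontr)
  assume "\<not> ?thesis"
  then obtain w where w: "w \<in> set (tverts s)" "w \<in> set (tverts t)" by auto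
  obtain ws where ws: "ws \<noteq> []" "hd ws = root_of s" "last ws = w" "length ws \<le> height s" "nonbacktracking (p # ws)"
    using tree_walk[OF assms(1) w(1)] by blast
  obtain vs where vs: "vs \<noteq> []" "hd vs = root_of t" "last vs = w" "length vs \<le> height t" "nonbacktracking (p # vs)"
    using tree_walk[OF assms(2) w(2)] by blast
  have "nonbacktracking (rev ws @ p # vs)"
    using ws vs assms(3) by (intro nonbacktracking_fork) auto
  then have "distinct (rev ws @ p # vs)"
    using ws vs assms(4) by (intro nonbacktracking_distinct) auto
  moreover have "w \<in> set ws" "w \<in> set vs" using ws vs last_in_set by metis+
  ultimately show False by auto
qed

lemma forest_distinct:
  assumes "\<And>t. t \<in> set ts \<Longrightarrow> tree_in W p t \<and> distinct (tverts t) \<and> height t \<le> 9"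
    and "distinct (map root_of ts)" "sorted_wrt (\<lambda>s t. height s + height t \<le> 9) ts"
  shows "distinct (p # concat (map tverts ts))"
  using assms
proof (induction ts)
  case (Cons t ts)
  have "set (tverts t) \<inter> set (tverts s) = {}" if "s \<in> set ts" for s
  proof (rule trees_disjoint)
    show "root_of t \<noteq> root_of s" using Cons.prems(2) that by auto
  qed (use Cons.prems that in auto)
  then show ?case
    using Cons tree_parent_notin[of W p t] by auto
qed simp

lemma tree_distinct:
  assumes "tree_in W p t" "height t \<le> 9"
  shows "distinct (tverts t)"
  using assms
proof (induction t arbitrary: p)
  case (Node v ts)
  have h: "height t \<le> 9" if "t \<in> set ts" for t
    using Node.prems(2) foldr_max_ge[of "height t" "map height ts"] that by auto
  have "distinct (v # concat (map tverts ts))"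
    using Node h by (intro forest_distinct[of ts W v]) auto
  then show ?case by simp
qed simp

section \<open>Extending a coloring over a deleted tree\<close>

definition core :: "'a set \<Rightarrow> 'a \<Rightarrow> 'a rtree list \<Rightarrow> bool" where
  "core W x ts \<longleftrightarrow> x \<in> W \<and> distinct (map root_of ts) \<and> N W x = root_of ` set ts \<and>
     sorted_wrt (\<lambda>s t. height s + height t \<le> 9) ts \<and> (\<forall>t\<in>set ts. tree_in W x t \<and> height t \<le> 9)"

lemma core_distinct: "core W x ts \<Longrightarrow> distinct (x # concat (map tverts ts))"
  using tree_distinct by (intro forest_distinct[of ts W x]) (auto simp: core_def)

lemma vertex_okI:
  assumes "c v < 4" "\<And>u. u \<in> N W v \<Longrightarrow> c u \<noteq> c v" "N W v = set us" "distinct us" "us = [] \<or> has_odd_count (map c us)"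
  shows "vertex_ok W c v"
  using assms card_eq_count_list[OF assms(4), of c] unfolding vertex_ok_def has_odd_count_def by auto

lemma valid_root_neq: "valid c0 ob g p t \<Longrightarrow> g (root_of t) \<noteq> g p"
  by (cases t) auto

lemma valid_vertex_ok:
  assumes "valid c0 ob g p t" "tree_in W p t" "v \<in> inner_of t"
  shows "vertex_ok W g v"
  using assms
proof (induction t arbitrary: p)
  case (Node w ts)
  show ?case
  proof (cases "v = w")
    case True
    show ?thesis
    proof (rule vertex_okI[of g v W "p # map root_of ts"])
      show "g u \<noteq> g v" if u: "u \<in> N W v" for u
      proof -
        consider "u = p" | t where "t \<in> set ts" "u = root_of t" using u Node.prems(2) True by auto
        then show ?thesis
          using Node.prems(1) True valid_root_neq[of c0 ob g w] by cases auto
      qed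
    qed (use Node.prems True in \<open>auto simp: comp_def\<close>)
  next
    case False
    then obtain t where t: "t \<in> set ts" "v \<in> inner_of t" using Node.prems by auto
    show ?thesis by (rule Node.IH[OF t(1) _ _ t(2)]) (use Node.prems t in auto)
  qed
qed simp

lemma tree_inner_nbr:
  assumes "tree_in W p t" "s \<in> inner_of t" "u \<in> N W s" "u \<notin> inner_of t" "u \<noteq> p"
  shows "(s, u) \<in> ext_arcs p t"
  using assms
proof (induction t arbitrary: p)
  case (Node w ts)
  show ?case
  proof (cases "s = w")
    case True
    then obtain t where t: "t \<in> set ts" "u = root_of t" using Node.prems by auto
    then have "u \<notin> inner_of t" using Node.prems by auto
    then have "t = Ext u" using Ext_if_root_notin_inner t(2) by blast
    then have "(s, u) \<in> ext_arcs w t" using True by (metis ext_arcs.simps(1) singletonI)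
    then show ?thesis using t by auto
  next
    case False
    then obtain t where t: "t \<in> set ts" "s \<in> inner_of t" using Node.prems by auto
    have "(s, u) \<in> ext_arcs w t" 
      by (rule Node.IH[OF t(1) _ t(2)]) (use Node.prems t in auto)
    then show ?thesis using t by auto
  qed
qed simp

text \<open>Minimality colors the rest \<open>D\<close>, and \<open>col\<close> supplies a color of
  \<open>x\<close> from which the deleted set \<open>S\<close> is colored. A vertex of
  \<open>D\<close> has at most one neighbour in \<open>S\<close>, so it sees at most one additional
  color, which has to differ from \<open>c0\<close> and \<open>ob\<close> there.\<close>

lemma core_colorable:
  assumes core: "core W x ts" and fin: "finite W"
    and IH: "\<And>W'. W' \<subset> W \<Longrightarrow> odd_colorable4 W'"
    and col: "\<And>c0 ob. (\<And>y. c0 y < 4 \<and> ob y \<noteq> c0 y \<and> (odd (card (N W y)) \<longrightarrow> 4 \<le> ob y)) \<Longrightarrow>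
       \<exists>\<alpha><4. (\<forall>t\<in>set ts. passable c0 ob t \<alpha>) \<and> (ts = [] \<or> odd (length ts) \<or> (\<exists>t\<in>set ts. flexible c0 ob t \<alpha>))"
  shows "odd_colorable4 W"
proof -
  define S where "S = insert x (\<Union>t\<in>set ts. inner_of t)"
  have xW: "x \<in> W" and dr: "distinct (map root_of ts)" and Nx: "N W x = root_of ` set ts"
    and wf: "\<And>t. t \<in> set ts \<Longrightarrow> tree_in W x t" "\<And>t. t \<in> set ts \<Longrightarrow> height t \<le> 9"
    using core by (auto simp: core_def)
  have dist: "distinct (x # concat (map tverts ts))" using core_distinct[OF core] .
  define D where "D = W - S"
  have "D \<subset> W" using xW by (auto simp: D_def S_def)
  then obtain c where c: "\<And>v. v \<in> D \<Longrightarrow> vertex_ok D c v" using IH[OF \<open>D \<subset> W\<close>] unfolding odd_colorable4_def by blast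
  \<comment> \<open>The value 0 outside \<open>D\<close> only keeps \<open>c0\<close> below 4
    everywhere, as \<open>col\<close> expects.\<close>
  define c0 where "c0 v = (if v \<in> D then c v else 0)" for v
  have c0: "vertex_ok D c0 v" if "v \<in> D" for v
  proof -
    have "{u \<in> N D v. c u = k} = {u \<in> N D v. c0 u = k}" for k by (auto simp: N_def c0_def)
    then show ?thesis using c[OF that] that by (auto simp: vertex_ok_def N_def c0_def)
  qed
  define P where "P y k \<longleftrightarrow> y \<in> D \<and> even (card (N W y)) \<and> odd (card {u \<in> N D y. c0 u = k})" for y k
  \<comment> \<open>The default 4 is not a color and so forbids nothing; it is taken in particular
    at all vertices of odd degree in \<open>W\<close>.\<close>
  define ob where "ob y = (if \<exists>k. P y k then (SOME k. P y k) else 4)" for y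
  have obP: "P y (ob y)" if "P y k" for y k
    unfolding ob_def using that someI_ex[of "P y"] by auto
  have ob_ge: "4 \<le> ob y \<or> P y (ob y)" for y
  proof (cases "\<exists>k. P y k")
    case True
    then show ?thesis using obP by blast
  qed (simp add: ob_def)
  have c4: "c0 y < 4" for y using c0 by (cases "y \<in> D") (auto simp: vertex_ok_def c0_def)
  have ob_ne: "ob y \<noteq> c0 y" for y
  proof (cases "P y (ob y)")
    case True
    then have "odd (card {u \<in> N D y. c0 u = ob y})" by (simp add: P_def)
    then have "{u \<in> N D y. c0 u = ob y} \<noteq> {}" by (metis card.empty even_zero)
    then show ?thesis using True c0[of y] by (auto simp: P_def vertex_ok_def)
  qed (use ob_ge[of y] c4[of y] in auto)
  have "c0 y < 4 \<and> ob y \<noteq> c0 y \<and> (odd (card (N W y)) \<longrightarrow> 4 \<le> ob y)" for y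
    using c4 ob_ne ob_ge[of y] by (auto simp: P_def)
  then obtain \<alpha> where \<alpha>: "\<alpha> < 4" "\<And>t. t \<in> set ts \<Longrightarrow> passable c0 ob t \<alpha>"
     "ts = [] \<or> odd (length ts) \<or> (\<exists>t\<in>set ts. flexible c0 ob t \<alpha>)"
    using col[of c0 ob] by blast
  have "distinct ts" using dr by (simp add: distinct_map)
  have "\<exists>b. (\<forall>t\<in>set ts. feasible c0 ob t \<alpha> (b t)) \<and> (ts = [] \<or> has_odd_count (map b ts))"
  proof (cases "ts = []")
    case False
    then show ?thesis using choose_children[of ts c0 ob \<alpha> "[]"] \<alpha> \<open>distinct ts\<close> by auto
  qed auto
  then obtain b where b: "\<And>t. t \<in> set ts \<Longrightarrow> feasible c0 ob t \<alpha> (b t)" "ts = [] \<or> has_odd_count (map b ts)"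
    by blast
  have "\<forall>t\<in>set ts. \<exists>h. h (root_of t) = b t \<and> (\<forall>g p. g p = \<alpha> \<longrightarrow> (\<forall>w\<in>set (tverts t). g w = h w) \<longrightarrow> valid c0 ob g p t)"
    using feasible_imp_valid[OF b(1)] tree_distinct[OF wf] by blast
  then obtain h where h: "\<And>t. t \<in> set ts \<Longrightarrow> h t (root_of t) = b t"
    "\<And>t g p. t \<in> set ts \<Longrightarrow> g p = \<alpha> \<Longrightarrow> (\<forall>w\<in>set (tverts t). g w = h t w) \<Longrightarrow> valid c0 ob g p t"
    by metis
  obtain H where H: "\<And>t. t\<in>set ts \<Longrightarrow> H (root_of t) = b t" "\<And>t w. t\<in>set ts \<Longrightarrow> w\<in>set (tverts t) \<Longrightarrow> H w = h t w"
    using merge_on_disjoint[of ts h b, OF _ h(1)] dist by auto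
  define g where "g w = (if w = x then \<alpha> else if w \<in> S then H w else c0 w)" for w
  have tvS: "w \<in> S \<or> (\<exists>s. (s, w) \<in> ext_arcs x t)" if "t \<in> set ts" "w \<in> set (tverts t)" for t w
  proof -
    have "w \<in> inner_of t \<or> (\<exists>s. (s, w) \<in> ext_arcs p t)" for p
      using that(2) by (induction t arbitrary: p) (auto, blast)
    then show ?thesis using that(1) by (auto simp: S_def)
  qed
  \<comment> \<open>\<open>H\<close> also gives colors to the kept leaves. Validity of
    \<open>gH\<close> shows that these are the old ones, so \<open>g\<close> and \<open>gH\<close>
    agree on every tree.\<close>
  define gH where "gH w = (if w = x then \<alpha> else H w)" for w
  have xt: "x \<notin> set (tverts t)" if "t \<in> set ts" for t using dist that by auto
  have vH: "valid c0 ob gH x t" if "t \<in> set ts" for t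
    using h(2)[of t gH x] H(2) xt that by (auto simp: gH_def)
  have gg: "g w = gH w" if tw: "t \<in> set ts" "w \<in> set (tverts t)" for t w
  proof (cases "w \<in> S")
    case False
    then obtain s where "(s, w) \<in> ext_arcs x t" using tvS[OF tw] by blast
    then have "gH w = c0 w" using valid_ext_arcs[OF vH[OF tw(1)]] by blast
    then show ?thesis using False by (auto simp: g_def S_def)
  qed (simp add: g_def gH_def)
  have v: "valid c0 ob g x t" if "t \<in> set ts" for t
    using h(2)[of t g x] gg H(2) xt that by (auto simp: g_def gH_def split: if_splits)
  have gD: "g w = c0 w" if "w \<in> D" for w using that by (auto simp: g_def D_def S_def)
  have ok_inner: "vertex_ok W g s" if "s \<in> S" for s
  proof (cases "s = x")
    case True
    show ?thesis unfolding True
    proof (rule vertex_okI[of g x W "map root_of ts"])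
      have "g (root_of t) = b t" if t: "t \<in> set ts" for t
        using gg[OF t root_in_tverts] H(1)[OF t] xt[OF t] root_in_tverts[of t] by (auto simp: gH_def)
      then have eq: "map g (map root_of ts) = map b ts" by simp
      show "map root_of ts = [] \<or> has_odd_count (map g (map root_of ts))" using b(2) unfolding eq by auto
      show "g u \<noteq> g x" if "u \<in> N W x" for u
        using that Nx valid_root_neq[OF v] by auto
    qed (use dr Nx \<alpha> in \<open>auto simp: g_def\<close>)
  next
    case False
    then show ?thesis using that valid_vertex_ok[OF v wf(1)] by (auto simp: S_def)
  qed
  have S_nbr: "(s, y) \<in> (\<Union>t\<in>set ts. ext_arcs x t)" if sy: "s \<in> S" "y \<in> D" "y \<in> N W s" for s y
  proof (cases "s = x")
    case True
    then obtain t where t: "t \<in> set ts" "y = root_of t" using sy Nx by auto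
    have "y \<notin> inner_of t" using sy t by (auto simp: D_def S_def)
    then have "t = Ext y" using Ext_if_root_notin_inner t(2) by blast
    then have "(s, y) \<in> ext_arcs x t" using True by simp
    then show ?thesis using t by blast
  next
    case False
    then obtain t where t: "t \<in> set ts" "s \<in> inner_of t" using sy by (auto simp: S_def)
    then show ?thesis using tree_inner_nbr[OF wf(1)[OF t(1)] t(2) sy(3)] sy(2)
      by (auto simp: D_def S_def)
  qed
  have ok_outer: "vertex_ok W g y" if y: "y \<in> D" for y
  proof (cases "N W y \<inter> S = {}")
    case True
    then have "N W y = N D y" by (auto simp: N_def D_def)
    moreover have "{u \<in> N D y. g u = k} = {u \<in> N D y. c0 u = k}" for k using gD by (auto simp: N_def)
    ultimately show ?thesis using c0[OF y] gD y by (auto simp: vertex_ok_def N_def)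
  next
    case False
    then obtain s where s: "s \<in> N W y" "s \<in> S" by auto
    have yW: "y \<in> W" using y by (auto simp: D_def)
    have arc: "(s', y) \<in> (\<Union>t\<in>set ts. ext_arcs x t)" if "s' \<in> N W y" "s' \<in> S" for s'
      using S_nbr[OF that(2) y] N_sym[OF yW that(1)] by blast
    obtain t where t: "t \<in> set ts" "(s, y) \<in> ext_arcs x t" using arc[OF s] by auto
    \<comment> \<open>Here the girth enters: the trees are disjoint with distinct vertices, so
      \<open>y\<close> occurs as a leaf only once.\<close>
    have uniq: "s' = s" if s': "s' \<in> N W y" "s' \<in> S" for s'
    proof -
      obtain t' where t': "t' \<in> set ts" "(s', y) \<in> ext_arcs x t'" using arc[OF s'] by auto
      have "t' = t"
        using distinct_concat_map_unique[of tverts ts t' t y] dist t t' ext_arcs_in_tverts by fastforce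
      then show ?thesis using ext_arcs_unique[of s' y x t s] t t' tree_distinct[OF wf] by blast
    qed
    have "N W y \<inter> S = {s}" using uniq s by blast
    moreover have "N W y = (N W y \<inter> S) \<union> N D y" by (auto simp: N_def D_def)
    ultimately have NW: "N W y = insert s (N D y)" by simp
    have sD: "s \<notin> N D y" using s by (auto simp: N_def D_def)
    have finD: "finite (N D y)" using fin by (simp add: N_def D_def)
    have gs: "g s \<noteq> c0 y" "g s \<noteq> ob y" using valid_ext_arcs[OF v[OF t(1)] t(2)] by auto
    have "\<exists>k. odd (card {u \<in> N W y. g u = k})"
    proof (cases "odd (card (N W y))")
      case True
      obtain us where us: "set us = N W y" "distinct us"
        using finite_distinct_list[of "N W y"] finD NW by auto
      have "has_odd_count (map g us)"
        using True us by (intro has_odd_count_odd_length) (auto simp: distinct_card[symmetric])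
      then show ?thesis using card_eq_count_list[OF us(2), of g] us(1) by (auto simp: has_odd_count_def)
    next
      case False
      \<comment> \<open>With even degree in \<open>W\<close>, the deleted neighbour cannot be the
        only one. So some color had an odd count at \<open>y\<close> in \<open>D\<close>;
        \<open>ob y\<close> is such a color, and \<open>g s \<noteq> ob y\<close> preserves its
        count.\<close>
      then have "N D y \<noteq> {}" using NW by auto
      then obtain k where "P y k" using c0[OF y] False y by (auto simp: vertex_ok_def P_def)
      then have "odd (card {u \<in> N D y. c0 u = ob y})" using obP by (auto simp: P_def)
      moreover have "{u \<in> N W y. g u = ob y} = {u \<in> N D y. c0 u = ob y}"
        using NW gs(2) gD sD by (auto simp: N_def)
      ultimately show ?thesis by metis
    qed
    moreover have "g u \<noteq> g y" if "u \<in> N W y" for u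
    proof -
      have "u = s \<or> u \<in> N D y" using that NW by blast
      then show ?thesis using c0[OF y] gs(1) gD[OF y] gD[of u] by (auto simp: vertex_ok_def N_def)
    qed
    moreover have "g y < 4" using c4 gD[OF y] by simp
    ultimately show ?thesis unfolding vertex_ok_def by blast
  qed
  show ?thesis unfolding odd_colorable4_def using ok_inner ok_outer by (auto simp: D_def)
qed

section \<open>Legs and the colors they admit\<close>

definition other :: "'a set \<Rightarrow> 'a \<Rightarrow> 'a \<Rightarrow> 'a" where
  "other W u p = (THE w. w \<in> N W u \<and> w \<noteq> p)"

lemma other:
  assumes "card (N W u) = 2" "p \<in> N W u"
  shows "N W u = {p, other W u p}" "other W u p \<noteq> p"
proof -
  obtain w where w: "N W u = {p, w}" "w \<noteq> p"
    using assms by (auto simp: card_2_iff doubleton_eq_iff)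
  then have "other W u p = w" unfolding other_def by auto
  then show "N W u = {p, other W u p}" "other W u p \<noteq> p" using w by auto
qed

lemma other_eq:
  assumes "N W u = {p, w}" "w \<noteq> p"
  shows "other W u p = w"
  using assms unfolding other_def by auto

text \<open>The maximal path of 2-vertices that starts at \<open>u\<close> and leads away from \<open>p\<close>, cut off after \<open>n\<close> vertices.\<close>

primrec leg :: "'a set \<Rightarrow> nat \<Rightarrow> 'a \<Rightarrow> 'a \<Rightarrow> 'a rtree" where
  "leg W 0 p u = Ext u"
| "leg W (Suc n) p u = (if card (N W u) = 2 then Node u [leg W n u (other W u p)] else Ext u)"

primrec leg_length :: "'a set \<Rightarrow> nat \<Rightarrow> 'a \<Rightarrow> 'a \<Rightarrow> nat" where
  "leg_length W 0 p u = 0"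
| "leg_length W (Suc n) p u = (if card (N W u) = 2 then Suc (leg_length W n u (other W u p)) else 0)"

primrec leg_end :: "'a set \<Rightarrow> nat \<Rightarrow> 'a \<Rightarrow> 'a \<Rightarrow> 'a" where
  "leg_end W 0 p u = u"
| "leg_end W (Suc n) p u = (if card (N W u) = 2 then leg_end W n u (other W u p) else u)"

lemma root_leg [simp]: "root_of (leg W n p u) = u"
  by (cases n) auto

lemma height_leg [simp]: "height (leg W n p u) = Suc (leg_length W n p u)"
  by (induction n arbitrary: p u) auto

text \<open>Lets the recursion, which lowers the cut-off by one per step, return to a fixed cut-off
  once the leg is known to end in time.\<close>

lemma leg_length_stable: "leg_length W (Suc n) p u \<le> n \<Longrightarrow> leg_length W n p u = leg_length W (Suc n) p u"
proof (induction n arbitrary: p u)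
  case (Suc n)
  show ?case
  proof (cases "card (N W u) = 2")
    case True
    then have "leg_length W (Suc n) u (other W u p) \<le> n"
      using Suc.prems leg_length.simps(2)[of W "Suc n" p u] by (metis Suc_le_mono)
    note IH = Suc.IH[OF this]
    show ?thesis
      unfolding leg_length.simps(2)[of W "Suc n" p u] leg_length.simps(2)[of W n p u] IH ..
  qed simp
qed (auto split: if_splits)

lemma leg_tree_in:
  assumes "p \<in> W" "u \<in> N W p"
  shows "tree_in W p (leg W n p u)"
  using assms
proof (induction n arbitrary: p u)
  case (Suc n)
  have uW: "u \<in> W" using Suc.prems by (auto simp: N_def)
  have pu: "p \<in> N W u" using N_sym Suc.prems by auto
  show ?case
  proof (cases "card (N W u) = 2")
    case True
    note o = other[OF True pu]
    have "other W u p \<in> N W u" using o by auto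
    then show ?thesis using Suc.IH[OF uW, of "other W u p"] Suc.prems o True by auto
  qed (use Suc.prems in auto)
qed simp

lemma leg_Suc:
  assumes "leg_length W n p u = Suc k"
  obtains m where "leg W n p u = Node u [leg W m u (other W u p)]"
    "leg_length W m u (other W u p) = k" "leg_end W n p u = leg_end W m u (other W u p)"
  using assms by (cases n) (auto split: if_splits)

lemma feasible_leg0:
  "leg_length W n p u = 0 \<Longrightarrow> feasible c0 ob (leg W n p u) \<alpha> \<beta> \<longleftrightarrow>
     \<beta> = c0 (leg_end W n p u) \<and> \<alpha> \<noteq> \<beta> \<and> \<alpha> \<noteq> ob (leg_end W n p u)"
  by (cases n) (auto split: if_splits)

lemma feasible_leg1:
  assumes "leg_length W n p u = 1"
  shows "feasible c0 ob (leg W n p u) \<alpha> \<beta> \<longleftrightarrow>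
     \<beta> < 4 \<and> \<alpha> \<noteq> \<beta> \<and> \<beta> \<noteq> c0 (leg_end W n p u) \<and> \<beta> \<noteq> ob (leg_end W n p u) \<and> \<alpha> \<noteq> c0 (leg_end W n p u)"
proof -
  obtain m where m: "leg W n p u = Node u [leg W m u (other W u p)]"
    "leg_length W m u (other W u p) = 0" "leg_end W n p u = leg_end W m u (other W u p)"
    using leg_Suc[of W n p u 0] assms by auto
  show ?thesis unfolding m(1,3) feasible_chain feasible_leg0[OF m(2)] by auto
qed

lemma feasible_leg2:
  assumes "leg_length W n p u = 2"
  shows "feasible c0 ob (leg W n p u) \<alpha> \<beta> \<longleftrightarrow>
     \<beta> < 4 \<and> \<alpha> \<noteq> \<beta> \<and> \<beta> \<noteq> c0 (leg_end W n p u) \<and>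
     (\<exists>b. b < 4 \<and> b \<noteq> \<beta> \<and> b \<noteq> c0 (leg_end W n p u) \<and> b \<noteq> ob (leg_end W n p u) \<and> b \<noteq> \<alpha>)"
proof -
  obtain m where m: "leg W n p u = Node u [leg W m u (other W u p)]"
    "leg_length W m u (other W u p) = 1" "leg_end W n p u = leg_end W m u (other W u p)"
    using leg_Suc[of W n p u 1] assms by auto
  show ?thesis unfolding m(1,3) feasible_chain feasible_leg1[OF m(2)] by auto
qed

lemma feasible_leg3:
  assumes "leg_length W n p u = 3"
  shows "feasible c0 ob (leg W n p u) \<alpha> \<beta> \<longleftrightarrow> \<beta> < 4 \<and> \<alpha> \<noteq> \<beta> \<and>
     (\<exists>b. b < 4 \<and> b \<noteq> \<alpha> \<and> b \<noteq> \<beta> \<and> b \<noteq> c0 (leg_end W n p u) \<and>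
     (\<exists>b'. b' < 4 \<and> b' \<noteq> b \<and> b' \<noteq> c0 (leg_end W n p u) \<and> b' \<noteq> ob (leg_end W n p u) \<and> b' \<noteq> \<beta>))"
proof -
  obtain m where m: "leg W n p u = Node u [leg W m u (other W u p)]"
    "leg_length W m u (other W u p) = 2" "leg_end W n p u = leg_end W m u (other W u p)"
    using leg_Suc[of W n p u 2] assms by auto
  show ?thesis unfolding m(1,3) feasible_chain feasible_leg2[OF m(2)] by auto
qed

lemma avoid_colors:
  assumes "finite F" "card F \<le> 3"
  shows "\<exists>\<alpha><4::nat. \<alpha> \<notin> F"
proof (rule ccontr)
  assume "\<not> ?thesis"
  then have "{..<4} \<subseteq> F" by auto
  then have "card {..<4::nat} \<le> card F" using assms(1) card_mono by blast
  then show False using assms(2) by simp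
qed

lemma ex_fourth_color: "\<exists>\<beta><4::nat. \<beta> \<noteq> x \<and> \<beta> \<noteq> y \<and> \<beta> \<noteq> z"
  using avoid_colors[of "{x, y, z}"] by (auto simp: card_insert_le_m1)

context
  fixes W n p u and c0 ob :: "'a \<Rightarrow> nat" and c o' :: nat
  assumes c: "c0 (leg_end W n p u) = c" "c < 4" and o': "ob (leg_end W n p u) = o'"
begin

lemma passable_leg0: "leg_length W n p u = 0 \<Longrightarrow> \<alpha> \<noteq> c \<Longrightarrow> \<alpha> \<noteq> o' \<Longrightarrow> passable c0 ob (leg W n p u) \<alpha>"
  unfolding passable_def by (intro exI[of _ c]) (simp add: feasible_leg0 c o')

lemma passable_leg1: "leg_length W n p u = 1 \<Longrightarrow> \<alpha> \<noteq> c \<Longrightarrow> passable c0 ob (leg W n p u) \<alpha>"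
  unfolding passable_def using ex_fourth_color[of \<alpha> c o'] by (auto simp: c o' feasible_leg1)

lemma flexible_leg1:
  assumes "leg_length W n p u = 1" "\<alpha> \<noteq> c" "4 \<le> o'"
  shows "flexible c0 ob (leg W n p u) \<alpha>"
proof -
  obtain \<beta> where b: "\<beta> < 4" "\<beta> \<noteq> \<alpha>" "\<beta> \<noteq> c" using ex_fourth_color[of \<alpha> c c] by auto
  obtain \<beta>' where b': "\<beta>' < 4" "\<beta>' \<noteq> \<alpha>" "\<beta>' \<noteq> c" "\<beta>' \<noteq> \<beta>"
    using ex_fourth_color[of \<alpha> c \<beta>] by auto
  show ?thesis unfolding flexible_def feasible_leg1[OF assms(1)] c o'
    using b b' assms by (intro exI[of _ \<beta>] exI[of _ \<beta>']) auto
qed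

lemma passable_leg2:
  assumes "leg_length W n p u = 2"
  shows "passable c0 ob (leg W n p u) \<alpha>"
proof -
  obtain b where b: "b < 4" "b \<noteq> \<alpha>" "b \<noteq> c" "b \<noteq> o'" using ex_fourth_color[of \<alpha> c o'] by auto
  obtain \<beta> where "\<beta> < 4" "\<beta> \<noteq> \<alpha>" "\<beta> \<noteq> c" "\<beta> \<noteq> b" using ex_fourth_color[of \<alpha> c b] by auto
  then show ?thesis unfolding passable_def feasible_leg2[OF assms(1)] c o'
    using b by (intro exI[of _ \<beta>]) auto
qed

text \<open>The second vertex of the leg must avoid \<beta>, \<open>c\<close>, \<open>o'\<close> and
  \<alpha>. Under the assumption at most three of these are distinct colors, so every \<beta> other
  than \<alpha> and \<open>c\<close> works, and at least two such colors exist.\<close>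

lemma flexible_leg2:
  assumes "leg_length W n p u = 2" "\<alpha> = c \<or> \<alpha> = o' \<or> 4 \<le> o'"
  shows "flexible c0 ob (leg W n p u) \<alpha>"
proof -
  have feas: "feasible c0 ob (leg W n p u) \<alpha> \<beta>" if "\<beta> < 4" "\<beta> \<noteq> \<alpha>" "\<beta> \<noteq> c" for \<beta>
  proof -
    have "\<exists>b<4. b \<noteq> \<beta> \<and> b \<noteq> c \<and> b \<noteq> o' \<and> b \<noteq> \<alpha>"
      using assms(2) ex_fourth_color[of \<beta> c o'] ex_fourth_color[of \<beta> c \<alpha>] by auto
    then show ?thesis unfolding feasible_leg2[OF assms(1)] c o' using that by auto
  qed
  obtain \<beta> where b: "\<beta> < 4" "\<beta> \<noteq> \<alpha>" "\<beta> \<noteq> c" using ex_fourth_color[of \<alpha> c c] by auto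
  obtain \<beta>' where b': "\<beta>' < 4" "\<beta>' \<noteq> \<alpha>" "\<beta>' \<noteq> c" "\<beta>' \<noteq> \<beta>"
    using ex_fourth_color[of \<alpha> c \<beta>] by auto
  show ?thesis unfolding flexible_def using feas b b' by metis
qed

text \<open>If \<alpha> or \<beta> equals \<open>c\<close>, the last vertex is colored first, and
  then the middle one has at most three colors to avoid. Otherwise \<alpha> itself can be repeated
  on the last vertex.\<close>

lemma feasible_leg3_if:
  assumes "leg_length W n p u = 3" "\<alpha> = c \<or> \<beta> = c \<or> \<alpha> \<noteq> o'" "\<beta> < 4" "\<beta> \<noteq> \<alpha>" "\<alpha> < 4"
  shows "feasible c0 ob (leg W n p u) \<alpha> \<beta>"
proof -
  have "\<exists>b b'. b < 4 \<and> b' < 4 \<and> b \<noteq> \<alpha> \<and> b \<noteq> \<beta> \<and> b \<noteq> c \<and> b' \<noteq> b \<and> b' \<noteq> c \<and> b' \<noteq> o' \<and> b' \<noteq> \<beta>"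
  proof (cases "\<alpha> = c \<or> \<beta> = c")
    case True
    obtain b' where b': "b' < 4" "b' \<noteq> c" "b' \<noteq> o'" "b' \<noteq> \<beta>" using ex_fourth_color[of c o' \<beta>] by auto
    have "\<exists>b<4. b \<noteq> \<alpha> \<and> b \<noteq> \<beta> \<and> b \<noteq> c \<and> b \<noteq> b'"
      using True ex_fourth_color[of \<alpha> \<beta> b'] by auto
    then show ?thesis using b' by metis
  next
    case False
    obtain b where "b < 4" "b \<noteq> \<alpha>" "b \<noteq> \<beta>" "b \<noteq> c" using ex_fourth_color[of \<alpha> \<beta> c] by auto
    then show ?thesis using False assms by (intro exI[of _ b] exI[of _ \<alpha>]) auto
  qed
  then show ?thesis unfolding feasible_leg3[OF assms(1)] c o' using assms by blast
qed

lemma passable_leg3: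
  assumes "leg_length W n p u = 3" "\<alpha> < 4"
  shows "passable c0 ob (leg W n p u) \<alpha>"
proof (cases "\<alpha> = c")
  case True
  obtain \<beta> where "\<beta> < 4" "\<beta> \<noteq> \<alpha>" using ex_fourth_color[of \<alpha> \<alpha> \<alpha>] by auto
  then show ?thesis using feasible_leg3_if[of \<alpha> \<beta>] True assms by (auto simp: passable_def)
next
  case False
  then show ?thesis using feasible_leg3_if[of \<alpha> c] c assms by (auto simp: passable_def)
qed

lemma flexible_leg3:
  assumes "leg_length W n p u = 3" "\<alpha> < 4" "\<alpha> \<noteq> o'"
  shows "flexible c0 ob (leg W n p u) \<alpha>"
proof -
  obtain \<beta> where b: "\<beta> < 4" "\<beta> \<noteq> \<alpha>" using ex_fourth_color[of \<alpha> \<alpha> \<alpha>] by auto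
  obtain \<beta>' where b': "\<beta>' < 4" "\<beta>' \<noteq> \<alpha>" "\<beta>' \<noteq> \<beta>" using ex_fourth_color[of \<alpha> \<beta> \<beta>] by auto
  show ?thesis unfolding flexible_def using feasible_leg3_if[of \<alpha>] assms b b' by metis
qed

end

section \<open>Configurations excluded by minimality\<close>

definition minimal_uncolorable :: "'a set \<Rightarrow> bool" where
  "minimal_uncolorable W \<longleftrightarrow> finite W \<and> \<not> odd_colorable4 W \<and> (\<forall>W'. W' \<subset> W \<longrightarrow> odd_colorable4 W')"

definition admissible :: "'a set \<Rightarrow> ('a \<Rightarrow> nat) \<Rightarrow> ('a \<Rightarrow> nat) \<Rightarrow> bool" where
  "admissible W c0 ob \<longleftrightarrow> (\<forall>y. c0 y < 4 \<and> ob y \<noteq> c0 y \<and> (odd (card (N W y)) \<longrightarrow> 4 \<le> ob y))"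

lemma reducible:
  assumes min: "minimal_uncolorable W" and x: "x \<in> W"
    and T: "\<And>u. u \<in> N W x \<Longrightarrow> tree_in W x (T u) \<and> root_of (T u) = u \<and> height (T u) \<le> 9"
    and ht: "\<And>u v. \<lbrakk>u \<in> N W x; v \<in> N W x; u \<noteq> v\<rbrakk> \<Longrightarrow> height (T u) + height (T v) \<le> 9"
    and col: "\<And>c0 ob. admissible W c0 ob \<Longrightarrow> \<exists>\<alpha><4. (\<forall>u\<in>N W x. passable c0 ob (T u) \<alpha>) \<and>
      (N W x = {} \<or> odd (card (N W x)) \<or> (\<exists>u\<in>N W x. flexible c0 ob (T u) \<alpha>))"
  shows False
proof -
  have fin: "finite W" using min by (simp add: minimal_uncolorable_def)
  then have "finite (N W x)" by (simp add: N_def)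
  then obtain us where us: "set us = N W x" "distinct us" using finite_distinct_list by blast
  have roots: "map root_of (map T us) = us" using T us by (auto intro: map_idI)
  have "sorted_wrt (\<lambda>s t. height s + height t \<le> 9) (map T us)"
    unfolding sorted_wrt_map by (rule sorted_wrt_distinct) (use us ht in auto)
  moreover have "N W x = root_of ` set (map T us)" using roots us by (metis set_map)
  ultimately have core: "core W x (map T us)"
    unfolding core_def roots using x us T by auto
  have "odd_colorable4 W"
  proof (rule core_colorable[OF core fin])
    show "odd_colorable4 W'" if "W' \<subset> W" for W' using min that by (simp add: minimal_uncolorable_def)
    fix c0 ob :: "'a \<Rightarrow> nat"
    assume "\<And>y. c0 y < 4 \<and> ob y \<noteq> c0 y \<and> (odd (card (N W y)) \<longrightarrow> 4 \<le> ob y)"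
    then have "admissible W c0 ob" by (simp add: admissible_def)
    then obtain \<alpha> where "\<alpha> < 4" "\<forall>u\<in>N W x. passable c0 ob (T u) \<alpha>"
      "N W x = {} \<or> odd (card (N W x)) \<or> (\<exists>u\<in>N W x. flexible c0 ob (T u) \<alpha>)" using col by blast
    then show "\<exists>\<alpha><4. (\<forall>t\<in>set (map T us). passable c0 ob t \<alpha>) \<and>
      (map T us = [] \<or> odd (length (map T us)) \<or> (\<exists>t\<in>set (map T us). flexible c0 ob t \<alpha>))"
      using us distinct_card[OF us(2)] by (intro exI[of _ \<alpha>]) auto
  qed
  then show False using min by (simp add: minimal_uncolorable_def)
qed

lemma minimal_degree:
  assumes min: "minimal_uncolorable W" and x: "x \<in> W"
  shows "2 \<le> card (N W x)"
proof (rule ccontr)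
  assume "\<not> ?thesis"
  moreover have fin: "finite (N W x)" using min by (simp add: minimal_uncolorable_def N_def)
  ultimately consider "N W x = {}" | u where "N W x = {u}"
    by (metis One_nat_def Suc_1 card_0_eq card_1_singletonE less_2_cases not_le)
  then show False
  proof cases
    case 1
    show False by (rule reducible[OF min x, of Ext]) (use 1 in \<open>auto intro: exI[of _ 0]\<close>)
  next
    case (2 u)
    show False
    proof (rule reducible[OF min x, of Ext])
      fix c0 ob assume "admissible W c0 ob"
      obtain \<alpha> where "\<alpha> < 4" "\<alpha> \<noteq> c0 u" "\<alpha> \<noteq> ob u" using ex_fourth_color[of "c0 u" "ob u" "ob u"] by auto
      then show "\<exists>\<alpha><4. (\<forall>u\<in>N W x. passable c0 ob (Ext u) \<alpha>) \<and>
        (N W x = {} \<or> odd (card (N W x)) \<or> (\<exists>u\<in>N W x. flexible c0 ob (Ext u) \<alpha>))"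
        using 2 by (intro exI[of _ \<alpha>]) (auto simp: passable_def)
    qed (use 2 in auto)
  qed
qed

text \<open>The cut-off 4 is one more than the bound to be proved: a value of at most 3 is the true
  length of the leg.\<close>

lemma leg_length_rec:
  "leg_length W 4 p u = (if card (N W u) = 2 then Suc (leg_length W 3 u (other W u p)) else 0)"
  using leg_length.simps(2)[of W 3 p u] by simp

text \<open>The second of four consecutive 2-vertices has legs of length 1 and 2.\<close>

lemma legs_short:
  assumes min: "minimal_uncolorable W" and p: "p \<in> W" and u: "u \<in> N W p"
  shows "leg_length W 4 p u \<le> 3"
proof (rule ccontr)
  assume "\<not> ?thesis"
  then have *: "leg_length W (Suc (Suc (Suc (Suc 0)))) p u \<ge> 4" by (simp add: numeral_eq_Suc)
  define u2 where "u2 = other W u p"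
  define u3 where "u3 = other W u2 u"
  have c: "card (N W u) = 2" "card (N W u2) = 2" "card (N W u3) = 2" "card (N W (other W u3 u2)) = 2"
    using * by (auto simp: u2_def u3_def split: if_splits)
  have pu: "p \<in> N W u" using N_sym[OF p u] .
  have u2: "N W u = {p, u2}" using other(1)[OF c(1) pu] by (simp add: u2_def)
  have uW: "u \<in> W" using u by (simp add: N_def)
  have "u2 \<in> N W u" using u2 by auto
  then have uu2: "u \<in> N W u2" and u2W: "u2 \<in> W" using N_sym[OF uW] by (auto simp: N_def)
  have u3: "N W u2 = {u, u3}" "u3 \<noteq> u" using other[OF c(2) uu2] by (simp_all add: u3_def)
  \<comment> \<open>The cut-offs 1 and 2 stop the legs of \<open>u2\<close> at exactly these
    lengths, whatever lies beyond.\<close>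
  define f where "f w = (if w = u then 1 else 2::nat)" for w
  have len: "leg_length W (f u) u2 u = 1" "leg_length W (f u3) u2 u3 = 2"
    using c u3 by (simp_all add: f_def numeral_2_eq_2)
  show False
  proof (rule reducible[OF min u2W, of "\<lambda>w. leg W (f w) u2 w"])
    fix c0 ob assume ad: "admissible W c0 ob"
    define e1 e2 where "e1 = leg_end W (f u) u2 u" and "e2 = leg_end W (f u3) u2 u3"
    have c4: "c0 e1 < 4" "c0 e2 < 4" "ob e2 \<noteq> c0 e2" using ad by (auto simp: admissible_def)
    \<comment> \<open>The colors \<open>c0 e2\<close> and \<open>ob e2\<close> differ and either
      makes the 2-leg flexible; the 1-leg forbids only \<open>c0 e1\<close>.\<close>
    have "\<exists>\<alpha><4. \<alpha> \<noteq> c0 e1 \<and> (\<alpha> = c0 e2 \<or> \<alpha> = ob e2 \<or> 4 \<le> ob e2)"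
    proof (cases "c0 e2 = c0 e1")
      case True
      then show ?thesis using c4 ex_fourth_color[of "c0 e1" "c0 e1" "c0 e1"] by (cases "ob e2 < 4") auto
    qed (use c4 in auto)
    then obtain \<alpha> where \<alpha>: "\<alpha> < 4" "\<alpha> \<noteq> c0 e1" "\<alpha> = c0 e2 \<or> \<alpha> = ob e2 \<or> 4 \<le> ob e2" by blast
    have "passable c0 ob (leg W (f u) u2 u) \<alpha>"
      using passable_leg1[where c = "c0 e1"] c4 len \<alpha> by (auto simp: e1_def)
    moreover have "passable c0 ob (leg W (f u3) u2 u3) \<alpha>"
      using passable_leg2[where c = "c0 e2"] c4 len \<alpha> by (auto simp: e2_def)
    moreover have "flexible c0 ob (leg W (f u3) u2 u3) \<alpha>"
      using flexible_leg2[where c = "c0 e2" and o' = "ob e2"] c4 len \<alpha> by (auto simp: e2_def)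
    ultimately show "\<exists>\<alpha><4. (\<forall>w\<in>N W u2. passable c0 ob (leg W (f w) u2 w) \<alpha>) \<and>
        (N W u2 = {} \<or> odd (card (N W u2)) \<or> (\<exists>w\<in>N W u2. flexible c0 ob (leg W (f w) u2 w) \<alpha>))"
      using \<alpha>(1) u3 by (intro exI[of _ \<alpha>]) auto
  qed (use u2W u3 len leg_tree_in in auto)
qed

text \<open>Recolor \<open>u2\<close> together with \<open>u\<close>. The vertex \<open>x\<close> at
  the end of this 1-leg has no spoiling color, which makes the leg flexible; \<open>c0 x\<close>,
  \<open>c0 u3\<close> and \<open>ob u3\<close> still leave a fourth color for
  \<open>u2\<close>.\<close>

lemma legs_at_odd:
  assumes min: "minimal_uncolorable W" and x: "x \<in> W" and u: "u \<in> N W x" and odd: "odd (card (N W x))"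
  shows "leg_length W 4 x u \<le> 1"
proof (rule ccontr)
  assume "\<not> ?thesis"
  then have *: "leg_length W (Suc (Suc (Suc (Suc 0)))) x u \<ge> 2" by (simp add: numeral_eq_Suc)
  define u2 where "u2 = other W u x"
  define u3 where "u3 = other W u2 u"
  have c: "card (N W u) = 2" "card (N W u2) = 2"
    using * by (auto simp: u2_def u3_def split: if_splits)
  have xu: "x \<in> N W u" using N_sym[OF x u] .
  have u2: "N W u = {x, u2}" "u2 \<noteq> x" using other[OF c(1) xu] by (simp_all add: u2_def)
  have uW: "u \<in> W" using u by (simp add: N_def)
  have "u2 \<in> N W u" using u2 by auto
  then have uu2: "u \<in> N W u2" and u2W: "u2 \<in> W" using N_sym[OF uW] by (auto simp: N_def)
  have u3: "N W u2 = {u, u3}" "u3 \<noteq> u" using other[OF c(2) uu2] by (simp_all add: u3_def)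
  have ox: "other W u u2 = x" using u2 by (intro other_eq) auto
  define f where "f w = (if w = u then 1 else 0::nat)" for w
  have len: "leg_length W (f u) u2 u = 1" "leg_length W (f u3) u2 u3 = 0"
    and ends: "leg_end W (f u) u2 u = x" "leg_end W (f u3) u2 u3 = u3"
    using c u3 ox by (simp_all add: f_def)
  show False
  proof (rule reducible[OF min u2W, of "\<lambda>w. leg W (f w) u2 w"])
    fix c0 ob assume ad: "admissible W c0 ob"
    have c4: "c0 x < 4" "c0 u3 < 4" "4 \<le> ob x" using ad odd by (auto simp: admissible_def)
    obtain \<alpha> where \<alpha>: "\<alpha> < 4" "\<alpha> \<noteq> c0 x" "\<alpha> \<noteq> c0 u3" "\<alpha> \<noteq> ob u3" using ex_fourth_color by blast
    have "passable c0 ob (leg W (f u) u2 u) \<alpha>"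
      using passable_leg1[where c = "c0 x"] c4 len \<alpha> ends by auto
    moreover have "passable c0 ob (leg W (f u3) u2 u3) \<alpha>"
      using passable_leg0[where c = "c0 u3" and o' = "ob u3"] c4 len \<alpha> ends by auto
    moreover have "flexible c0 ob (leg W (f u) u2 u) \<alpha>"
      using flexible_leg1[where c = "c0 x" and o' = "ob x"] c4 len \<alpha> ends by auto
    ultimately show "\<exists>\<alpha><4. (\<forall>w\<in>N W u2. passable c0 ob (leg W (f w) u2 w) \<alpha>) \<and>
        (N W u2 = {} \<or> odd (card (N W u2)) \<or> (\<exists>w\<in>N W u2. flexible c0 ob (leg W (f w) u2 w) \<alpha>))"
      using \<alpha>(1) u3 by (intro exI[of _ \<alpha>]) auto
  qed (use u2W u3 len leg_tree_in in auto)
qed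

definition leg_count :: "'a set \<Rightarrow> nat \<Rightarrow> 'a \<Rightarrow> nat" where
  "leg_count W k x = card {u \<in> N W x. leg_length W 4 x u = k}"

text \<open>In the discharging, these are the only vertices that cannot pay for their legs.\<close>

definition poor :: "'a set \<Rightarrow> 'a \<Rightarrow> bool" where
  "poor W x \<longleftrightarrow> card (N W x) = 4 \<and> leg_count W 3 x = 2 \<and> leg_count W 1 x = 1 \<and> leg_count W 0 x = 1"

definition branch :: "'a set \<Rightarrow> 'a \<Rightarrow> 'a \<Rightarrow> 'a rtree" where
  "branch W x b = Node b (map (leg W 4 b) (SOME vs. set vs = N W b - {x} \<and> distinct vs))"

lemma branch_list:
  assumes "finite W"
  obtains vs where "branch W x b = Node b (map (leg W 4 b) vs)" "set vs = N W b - {x}" "distinct vs"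
proof -
  have "finite (N W b - {x})" using assms by (simp add: N_def)
  then have "\<exists>vs. set vs = N W b - {x} \<and> distinct vs" using finite_distinct_list by blast
  from someI_ex[OF this] show ?thesis using that unfolding branch_def by blast
qed

text \<open>The height 5 is \<open>b\<close> itself, three 2-vertices and a kept end; next to a leg
  of height 4 it just meets the bound 9.\<close>

lemma branch_tree_in:
  assumes min: "minimal_uncolorable W" and x: "x \<in> W" and b: "b \<in> N W x"
  shows "tree_in W x (branch W x b)" "root_of (branch W x b) = b" "height (branch W x b) \<le> 5"
proof -
  have fin: "finite W" using min by (simp add: minimal_uncolorable_def)
  obtain vs where vs: "branch W x b = Node b (map (leg W 4 b) vs)" "set vs = N W b - {x}" "distinct vs"
    using branch_list[OF fin] .
  have bW: "b \<in> W" using b by (simp add: N_def)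
  have xb: "x \<in> N W b" using N_sym[OF x b] .
  have ht: "height (leg W 4 b v) \<le> 4" if "v \<in> set vs" for v
    using legs_short[OF min bW, of v] that vs by simp
  have roots: "map root_of (map (leg W 4 b) vs) = vs" by (simp add: comp_def)
  have "sorted_wrt (\<lambda>s t. height s + height t \<le> 9) (map (leg W 4 b) vs)"
    unfolding sorted_wrt_map
  proof (rule sorted_wrt_distinct[OF vs(3)])
    fix v w assume "v \<in> set vs" "w \<in> set vs"
    then show "height (leg W 4 b v) + height (leg W 4 b w) \<le> 9" using ht[of v] ht[of w] by linarith
  qed
  moreover have "root_of ` set (map (leg W 4 b) vs) = set vs" by (simp add: image_image)
  moreover have "tree_in W b (leg W 4 b v)" if "v \<in> set vs" for v
    using that vs bW by (intro leg_tree_in) auto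
  ultimately show "tree_in W x (branch W x b)"
    unfolding vs(1) tree_in.simps roots using b vs(2,3) xb by auto
  show "root_of (branch W x b) = b" by (simp add: vs(1))
  have "foldr max (map height (map (leg W 4 b) vs)) 0 \<le> 4"
    using ht by (intro foldr_max_le) auto
  then show "height (branch W x b) \<le> 5" unfolding vs(1) by simp
qed

text \<open>The root only has to avoid the parent, the end of its 1-leg and one color spoiling a 3-leg.\<close>

lemma branch_passable:
  assumes min: "minimal_uncolorable W" and x: "x \<in> W" and b: "b \<in> N W x"
    and poor: "poor W b" and bx: "leg_length W 4 b x = 0" and ad: "admissible W c0 ob"
  shows "passable c0 ob (branch W x b) \<alpha>"
proof -
  have fin: "finite W" using min by (simp add: minimal_uncolorable_def)
  obtain vs where vs: "branch W x b = Node b (map (leg W 4 b) vs)" "set vs = N W b - {x}" "distinct vs"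
    using branch_list[OF fin] .
  have bW: "b \<in> W" using b by (simp add: N_def)
  have xb: "x \<in> N W b" using N_sym[OF x b] .
  have c4: "c0 y < 4" for y using ad by (simp add: admissible_def)
  obtain x' where x': "{u \<in> N W b. leg_length W 4 b u = 0} = {x'}"
    using poor by (auto simp: poor_def leg_count_def card_1_singleton_iff)
  \<comment> \<open>The only 0-leg of the poor vertex \<open>b\<close> points back to
    \<open>x\<close>, so no child in the branch is a 0-leg.\<close>
  have only0: "u = x" if "u \<in> N W b" "leg_length W 4 b u = 0" for u
  proof -
    have "u \<in> {x'}" "x \<in> {x'}" unfolding x'[symmetric] using that bx xb by auto
    then show ?thesis by simp
  qed
  obtain u1 where u1: "{u \<in> N W b. leg_length W 4 b u = 1} = {u1}"
    using poor by (auto simp: poor_def leg_count_def card_1_singleton_iff)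
  have "{u \<in> N W b. leg_length W 4 b u = 3} \<noteq> {}"
    using poor unfolding poor_def leg_count_def by (metis card.empty zero_neq_numeral)
  then obtain u3 where u3: "u3 \<in> N W b" "leg_length W 4 b u3 = 3" by blast
  have "u3 \<noteq> x" using u3(2) bx by (metis zero_neq_numeral)
  then have u3vs: "u3 \<in> set vs" using u3(1) unfolding vs(2) by blast
  obtain \<beta> where \<beta>: "\<beta> < 4" "\<beta> \<noteq> \<alpha>" "\<beta> \<noteq> c0 (leg_end W 4 b u1)" "\<beta> \<noteq> ob (leg_end W 4 b u3)"
    using ex_fourth_color[of \<alpha> "c0 (leg_end W 4 b u1)" "ob (leg_end W 4 b u3)"] by blast
  have pass: "passable c0 ob (leg W 4 b v) \<beta>" if v: "v \<in> set vs" for v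
  proof -
    have "leg_length W 4 b v \<le> 3" using legs_short[OF min bW, of v] v vs(2) by simp
    moreover have "leg_length W 4 b v \<noteq> 0" using only0 v vs(2) by auto
    ultimately consider "leg_length W 4 b v = 1" | "leg_length W 4 b v = 2" | "leg_length W 4 b v = 3" by linarith
    then show ?thesis
    proof cases
      case 1
      then have "v = u1" using u1 v vs(2) by blast
      then show ?thesis using passable_leg1[OF refl c4 refl 1] \<beta> by auto
    next
      case 2
      then show ?thesis using passable_leg2[OF refl c4 refl] by auto
    next
      case 3
      then show ?thesis using passable_leg3[OF refl c4 refl] \<beta> by auto
    qed
  qed
  have flex: "flexible c0 ob (leg W 4 b u3) \<beta>"
    using flexible_leg3[OF refl c4 refl u3(2)] \<beta> by auto
  have "distinct (map root_of (map (leg W 4 b) vs))" using vs(3) by (simp add: comp_def)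
  then have "distinct (map (leg W 4 b) vs)" by (simp only: distinct_map)
  then obtain g where g: "\<forall>t\<in>set (map (leg W 4 b) vs). feasible c0 ob t \<beta> (g t)"
      "has_odd_count ([\<alpha>] @ map g (map (leg W 4 b) vs))"
    using choose_children[of "map (leg W 4 b) vs" c0 ob \<beta> "[\<alpha>]"] pass flex u3vs by auto
  have "feasible c0 ob (branch W x b) \<alpha> \<beta>"
    unfolding vs(1) feasible.simps using g \<beta> by (intro conjI exI[of _ g]) auto
  then show ?thesis unfolding passable_def by blast
qed

text \<open>\<open>B\<close> holds the neighbours whose leg is replaced by a branch; a branch never restricts the color of \<open>x\<close>.\<close>

definition forbidden :: "'a set \<Rightarrow> 'a \<Rightarrow> 'a set \<Rightarrow> ('a \<Rightarrow> nat) \<Rightarrow> ('a \<Rightarrow> nat) \<Rightarrow> 'a \<Rightarrow> nat set" where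
  "forbidden W x B c0 ob u = (if u \<in> B then {} else if leg_length W 4 x u = 0
     then (if odd (card (N W u)) then {c0 u} else {c0 u, ob u})
     else if leg_length W 4 x u = 1 then {c0 (leg_end W 4 x u)} else {})"

text \<open>Bounds the number of colors in \<open>forbidden\<close> independently of
  \<open>c0\<close> and \<open>ob\<close>.\<close>

definition weight :: "'a set \<Rightarrow> 'a \<Rightarrow> 'a set \<Rightarrow> 'a \<Rightarrow> nat" where
  "weight W x B u = (if u \<in> B then 0 else if leg_length W 4 x u = 0
     then (if odd (card (N W u)) then 1 else 2) else if leg_length W 4 x u = 1 then 1 else 0)"

text \<open>At most one branch is allowed: two of them could have heights with sum 10.\<close>

definition free_set :: "'a set \<Rightarrow> 'a \<Rightarrow> 'a set \<Rightarrow> bool" where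
  "free_set W x B \<longleftrightarrow> B = {} \<or> (\<exists>b \<in> N W x. B = {b} \<and> poor W b \<and> leg_length W 4 b x = 0)"

lemma card_forbidden:
  assumes "finite W"
  shows "card (\<Union>u\<in>N W x. forbidden W x B c0 ob u) \<le> (\<Sum>u\<in>N W x. weight W x B u)"
    "finite (\<Union>u\<in>N W x. forbidden W x B c0 ob u)"
proof -
  have fin: "finite (N W x)" using assms by (simp add: N_def)
  have "card (\<Union>u\<in>N W x. forbidden W x B c0 ob u) \<le> (\<Sum>u\<in>N W x. card (forbidden W x B c0 ob u))"
    by (rule card_UN_le[OF fin])
  also have "\<dots> \<le> (\<Sum>u\<in>N W x. weight W x B u)"
    by (rule sum_mono) (auto simp: forbidden_def weight_def card_insert_if)
  finally show "card (\<Union>u\<in>N W x. forbidden W x B c0 ob u) \<le> (\<Sum>u\<in>N W x. weight W x B u)" .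
  show "finite (\<Union>u\<in>N W x. forbidden W x B c0 ob u)" using fin by (auto simp: forbidden_def)
qed

lemma leg_end0: "leg_length W n p u = 0 \<Longrightarrow> leg_end W n p u = u"
  by (cases n) (auto split: if_splits)

text \<open>Flexibility is asked of a leg outside \<open>B\<close>, as branches are only known to be
  passable.\<close>

lemma reducible_legs:
  assumes min: "minimal_uncolorable W" and x: "x \<in> W" and B: "free_set W x B"
    and col: "\<And>c0 ob. admissible W c0 ob \<Longrightarrow> \<exists>\<alpha><4. \<alpha> \<notin> (\<Union>u\<in>N W x. forbidden W x B c0 ob u) \<and>
      (odd (card (N W x)) \<or> (\<exists>u\<in>N W x - B. flexible c0 ob (leg W 4 x u) \<alpha>))"
  shows False
proof (rule reducible[OF min x, of "\<lambda>u. if u \<in> B then branch W x u else leg W 4 x u"])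
  have ht: "height (leg W 4 x u) \<le> 4" if "u \<in> N W x" for u using legs_short[OF min x that] by simp
  show "tree_in W x (if u \<in> B then branch W x u else leg W 4 x u) \<and>
      root_of (if u \<in> B then branch W x u else leg W 4 x u) = u \<and>
      height (if u \<in> B then branch W x u else leg W 4 x u) \<le> 9" if u: "u \<in> N W x" for u
    using branch_tree_in[OF min x u] leg_tree_in[OF x u, of 4] ht[OF u] by simp
  show "height (if u \<in> B then branch W x u else leg W 4 x u) + height (if v \<in> B then branch W x v else leg W 4 x v) \<le> 9"
    if uv: "u \<in> N W x" "v \<in> N W x" "u \<noteq> v" for u v
  proof -
    have "\<not> (u \<in> B \<and> v \<in> B)" using B uv(3) by (auto simp: free_set_def)
    then show ?thesis
      using branch_tree_in(3)[OF min x uv(1)] branch_tree_in(3)[OF min x uv(2)] ht[OF uv(1)] ht[OF uv(2)] by auto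
  qed
  fix c0 ob assume ad: "admissible W c0 ob"
  obtain \<alpha> where "\<alpha> < 4 \<and> \<alpha> \<notin> (\<Union>u\<in>N W x. forbidden W x B c0 ob u) \<and>
      (odd (card (N W x)) \<or> (\<exists>u\<in>N W x - B. flexible c0 ob (leg W 4 x u) \<alpha>))" using col[OF ad] ..
  then have \<alpha>: "\<alpha> < 4" "\<And>u. u \<in> N W x \<Longrightarrow> \<alpha> \<notin> forbidden W x B c0 ob u"
     "odd (card (N W x)) \<or> (\<exists>u\<in>N W x - B. flexible c0 ob (leg W 4 x u) \<alpha>)" by auto
  have c4: "c0 y < 4" for y using ad by (simp add: admissible_def)
  have pass: "passable c0 ob (if u \<in> B then branch W x u else leg W 4 x u) \<alpha>" if u: "u \<in> N W x" for u
  proof (cases "u \<in> B")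
    case True
    then have "poor W u" "leg_length W 4 u x = 0" using B by (auto simp: free_set_def)
    then show ?thesis using branch_passable[OF min x u _ _ ad] True by simp
  next
    case False
    note f = \<alpha>(2)[OF u]
    have "leg_length W 4 x u \<le> 3" using legs_short[OF min x u] .
    then consider "leg_length W 4 x u = 0" | "leg_length W 4 x u = 1" | "leg_length W 4 x u = 2" | "leg_length W 4 x u = 3"
      by linarith
    then have "passable c0 ob (leg W 4 x u) \<alpha>"
    proof cases
      case 1
      have "\<alpha> \<noteq> c0 u" "\<alpha> \<noteq> ob u" using f False 1 ad \<alpha>(1) by (auto simp: forbidden_def admissible_def split: if_splits)
      then show ?thesis using passable_leg0[where ?c0.0 = c0 and ob = ob, OF refl c4 refl 1] leg_end0[OF 1] by simp
    next
      case 2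
      then show ?thesis using passable_leg1[where ?c0.0 = c0 and ob = ob, OF refl c4 refl 2] f False by (auto simp: forbidden_def)
    next
      case 3
      then show ?thesis using passable_leg2[where ?c0.0 = c0 and ob = ob, OF refl c4 refl 3] by simp
    next
      case 4
      then show ?thesis using passable_leg3[where ?c0.0 = c0 and ob = ob, OF refl c4 refl 4] \<alpha>(1) by simp
    qed
    then show ?thesis using False by simp
  qed
  have "odd (card (N W x)) \<or> (\<exists>u\<in>N W x. flexible c0 ob (if u \<in> B then branch W x u else leg W 4 x u) \<alpha>)"
    using \<alpha>(3) by auto
  then show "\<exists>\<alpha><4. (\<forall>u\<in>N W x. passable c0 ob (if u \<in> B then branch W x u else leg W 4 x u) \<alpha>) \<and>
      (N W x = {} \<or> odd (card (N W x)) \<or> (\<exists>u\<in>N W x. flexible c0 ob (if u \<in> B then branch W x u else leg W 4 x u) \<alpha>))"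
    using \<alpha>(1) pass by blast
qed

text \<open>With odd degree every color that is not forbidden will do, so three forbidden colors are
  harmless.\<close>

lemma weight_odd:
  assumes min: "minimal_uncolorable W" and x: "x \<in> W" and odd: "odd (card (N W x))"
  shows "3 < (\<Sum>u\<in>N W x. weight W x {} u)"
proof (rule ccontr)
  assume "\<not> ?thesis"
  then have le: "(\<Sum>u\<in>N W x. weight W x {} u) \<le> 3" by simp
  have fin: "finite W" using min by (simp add: minimal_uncolorable_def)
  show False
  proof (rule reducible_legs[OF min x, of "{}"])
    fix c0 ob
    show "\<exists>\<alpha><4. \<alpha> \<notin> (\<Union>u\<in>N W x. forbidden W x {} c0 ob u) \<and>
      (odd (card (N W x)) \<or> (\<exists>u\<in>N W x - {}. flexible c0 ob (leg W 4 x u) \<alpha>))"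
      using avoid_colors[OF card_forbidden(2)[OF fin]] card_forbidden(1)[OF fin, of x "{}" c0 ob] le odd
      by (meson order_trans)
  qed (simp add: free_set_def)
qed

text \<open>The 3-leg is flexible for every color but the one spoiling its end. This is one more
  color to avoid, so two forbidden colors are harmless.\<close>

lemma weight_leg3:
  assumes min: "minimal_uncolorable W" and x: "x \<in> W" and B: "free_set W x B"
    and u: "u \<in> N W x - B" "leg_length W 4 x u = 3"
  shows "2 < (\<Sum>u\<in>N W x. weight W x B u)"
proof (rule ccontr)
  assume "\<not> ?thesis"
  then have le: "(\<Sum>u\<in>N W x. weight W x B u) \<le> 2" by simp
  have fin: "finite W" using min by (simp add: minimal_uncolorable_def)
  show False
  proof (rule reducible_legs[OF min x B])
    fix c0 ob assume "admissible W c0 ob"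
    then have c4: "c0 y < 4" for y by (simp add: admissible_def)
    let ?F = "\<Union>u\<in>N W x. forbidden W x B c0 ob u"
    have "card (insert (ob (leg_end W 4 x u)) ?F) \<le> 3"
      using card_forbidden[OF fin, of x B c0 ob] le by (auto simp: card_insert_if)
    then obtain \<alpha> where "\<alpha> < 4" "\<alpha> \<notin> insert (ob (leg_end W 4 x u)) ?F"
      using avoid_colors[of "insert (ob (leg_end W 4 x u)) ?F"] card_forbidden(2)[OF fin] by auto
    then show "\<exists>\<alpha><4. \<alpha> \<notin> ?F \<and> (odd (card (N W x)) \<or> (\<exists>u\<in>N W x - B. flexible c0 ob (leg W 4 x u) \<alpha>))"
      using flexible_leg3[where ?c0.0 = c0 and ob = ob, OF refl c4 refl u(2)] u(1) by blast
  qed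
qed

text \<open>The 2-leg is flexible for both \<open>c0\<close> and \<open>ob\<close> of its end. These
  are distinct, so one forbidden color leaves one of them; if \<open>ob\<close> is no color, any
  color will do.\<close>

lemma weight_leg2:
  assumes min: "minimal_uncolorable W" and x: "x \<in> W" and B: "free_set W x B"
    and u: "u \<in> N W x - B" "leg_length W 4 x u = 2"
  shows "1 < (\<Sum>u\<in>N W x. weight W x B u)"
proof (rule ccontr)
  assume "\<not> ?thesis"
  then have le: "(\<Sum>u\<in>N W x. weight W x B u) \<le> 1" by simp
  have fin: "finite W" using min by (simp add: minimal_uncolorable_def)
  show False
  proof (rule reducible_legs[OF min x B])
    fix c0 ob assume ad: "admissible W c0 ob"
    then have c4: "c0 y < 4" for y by (simp add: admissible_def)
    let ?F = "\<Union>u\<in>N W x. forbidden W x B c0 ob u"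
    let ?e = "leg_end W 4 x u"
    have F: "card ?F \<le> 1" "finite ?F" using card_forbidden[OF fin, of x B c0 ob] le by auto
    have "\<exists>\<alpha><4. \<alpha> \<notin> ?F \<and> (\<alpha> = c0 ?e \<or> \<alpha> = ob ?e \<or> 4 \<le> ob ?e)"
    proof (cases "4 \<le> ob ?e")
      case True
      then show ?thesis using avoid_colors[OF F(2)] F(1) by fastforce
    next
      case False
      have "\<not> {c0 ?e, ob ?e} \<subseteq> ?F"
      proof
        assume sub: "{c0 ?e, ob ?e} \<subseteq> ?F"
        have "card {c0 ?e, ob ?e} \<le> 1" using card_mono[OF F(2) sub] F(1) by linarith
        moreover have "c0 ?e \<noteq> ob ?e" using ad by (metis admissible_def)
        ultimately show False by simp
      qed
      then obtain \<alpha> where "\<alpha> \<in> {c0 ?e, ob ?e}" "\<alpha> \<notin> ?F" by blast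
      then show ?thesis using False c4[of ?e] by (intro exI[of _ \<alpha>]) auto
    qed
    then obtain \<alpha> where \<alpha>: "\<alpha> < 4" "\<alpha> \<notin> ?F" "\<alpha> = c0 ?e \<or> \<alpha> = ob ?e \<or> 4 \<le> ob ?e" by blast
    then have "flexible c0 ob (leg W 4 x u) \<alpha>" using flexible_leg2[where ?c0.0 = c0 and ob = ob, OF refl c4 refl u(2)] by blast
    then show "\<exists>\<alpha><4. \<alpha> \<notin> ?F \<and> (odd (card (N W x)) \<or> (\<exists>u\<in>N W x - B. flexible c0 ob (leg W 4 x u) \<alpha>))"
      using \<alpha> u(1) by blast
  qed
qed

end

section \<open>Discharging\<close>

text \<open>\<open>n0\<close> to \<open>n3\<close> count the legs by length and \<open>w\<close> is
  the weight: long legs are expensive, but they force a large weight and hence short legs.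
  \<open>np\<close> excludes the one distribution that ends up one unit short.\<close>

lemma charge_without_poor_neighbour:
  fixes n0 n1 n2 n3 w :: nat
  assumes w: "w \<le> 2 * n0 + n1" "n3 \<noteq> 0 \<Longrightarrow> 2 < w" "n2 \<noteq> 0 \<Longrightarrow> 1 < w"
    and "3 \<le> n0 + n1 + n2 + n3" "even (n0 + n1 + n2 + n3)"
    and np: "\<not> (n0 = 1 \<and> n1 = 1 \<and> n2 = 0 \<and> n3 = 2)"
  shows "n1 + 2 * n2 + 3 * n3 + 10 \<le> 4 * n0 + 4 * n1 + 4 * n2 + 4 * n3"
proof -
  have ge4: "4 \<le> n0 + n1 + n2 + n3" using assms(4,5) by presburger
  have "n3 = 0 \<or> 1 \<le> n3 \<and> 3 \<le> w" "n2 = 0 \<or> 1 \<le> n2 \<and> 2 \<le> w" using w by auto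
  then consider "n3 = 0" "n2 = 0" | "n3 = 0" "1 \<le> n2" "2 \<le> w" | "1 \<le> n3" "3 \<le> w" "n0 = 0"
    | "2 \<le> n0" | "n0 = 1" "2 \<le> n1" "1 \<le> n3" | "n0 = 1" "n1 \<le> 1" "1 \<le> n3" "3 \<le> w" by linarith
  then show ?thesis
  proof cases
    case 6
    then have n1: "n1 = 1" using w by linarith
    show ?thesis
    proof (cases "n2 = 0")
      case True
      then have "n3 \<noteq> 2" using np n1 6 by simp
      then have "3 \<le> n3" using True n1 6 ge4 by linarith
      then show ?thesis using True n1 6 by linarith
    next
      case False
      then have "1 \<le> n2" by simp
      then show ?thesis using n1 6 ge4 by linarith
    qed
  qed (use w(1) ge4 in linarith)+
qed

text \<open>Turning one poor neighbour into a branch lowers the weight by 2. The additional short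
  legs that this forces pay for all \<open>z\<close> poor neighbours.\<close>

lemma charge_with_poor_neighbour:
  fixes n0 n1 n2 n3 w z :: nat
  assumes w: "w + 2 \<le> 2 * n0 + n1" "n3 \<noteq> 0 \<Longrightarrow> 2 < w" "n2 \<noteq> 0 \<Longrightarrow> 1 < w"
    and "3 \<le> n0 + n1 + n2 + n3" "even (n0 + n1 + n2 + n3)" and z: "z \<le> n0"
  shows "n1 + 2 * n2 + 3 * n3 + 10 + z \<le> 4 * n0 + 4 * n1 + 4 * n2 + 4 * n3"
proof -
  have ge4: "4 \<le> n0 + n1 + n2 + n3" using assms(4,5) by presburger
  have "n3 = 0 \<or> 1 \<le> n3 \<and> 3 \<le> w" "n2 = 0 \<or> 1 \<le> n2 \<and> 2 \<le> w" using w by auto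
  then consider "n3 = 0" "n2 = 0" | "n3 = 0" "1 \<le> n2" "2 \<le> w" | "1 \<le> n3" "3 \<le> w" by linarith
  then show ?thesis
  proof cases
    case 3
    then have "3 \<le> n0 + n1" using w by linarith
    then show ?thesis using 3 z by linarith
  qed (use w(1) ge4 z in linarith)+
qed

section \<open>Charge transfers in a minimal uncolorable set\<close>

context girth10_graph
begin

lemma leg_count_sum:
  assumes "finite W"
  shows "leg_count W k x = (\<Sum>u\<in>N W x. of_bool (leg_length W 4 x u = k))"
proof -
  have "finite (N W x)" using assms by (simp add: N_def)
  then show ?thesis
    unfolding leg_count_def by (simp add: Int_def)
qed

lemma leg_counts:
  assumes min: "minimal_uncolorable W" and x: "x \<in> W"
  shows "card (N W x) = leg_count W 0 x + leg_count W 1 x + leg_count W 2 x + leg_count W 3 x"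
    and "(\<Sum>u\<in>N W x. leg_length W 4 x u) = leg_count W 1 x + 2 * leg_count W 2 x + 3 * leg_count W 3 x"
    and "(\<Sum>u\<in>N W x. weight W x {} u) \<le> 2 * leg_count W 0 x + leg_count W 1 x"
    and "\<lbrakk>b \<in> N W x; leg_length W 4 x b = 0\<rbrakk> \<Longrightarrow>
       (\<Sum>u\<in>N W x. weight W x {b} u) + 2 \<le> 2 * leg_count W 0 x + leg_count W 1 x"
proof -
  have fin: "finite W" using min by (simp add: minimal_uncolorable_def)
  have finN: "finite (N W x)" using fin by (simp add: N_def)
  let ?i = "\<lambda>k u. of_bool (leg_length W 4 x u = k) :: nat"
  have cases: "leg_length W 4 x u = 0 \<or> leg_length W 4 x u = 1 \<or> leg_length W 4 x u = 2 \<or> leg_length W 4 x u = 3"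
    if "u \<in> N W x" for u using legs_short[OF min x that] by linarith
  have "(\<Sum>u\<in>N W x. 1) = (\<Sum>u\<in>N W x. ?i 0 u + ?i 1 u + ?i 2 u + ?i 3 u)"
  proof (rule sum.cong[OF refl])
    fix u assume "u \<in> N W x"
    from cases[OF this] show "1 = ?i 0 u + ?i 1 u + ?i 2 u + ?i 3 u" by (elim disjE) simp_all
  qed
  then show "card (N W x) = leg_count W 0 x + leg_count W 1 x + leg_count W 2 x + leg_count W 3 x"
    unfolding leg_count_sum[OF fin] sum.distrib by simp
  have "(\<Sum>u\<in>N W x. leg_length W 4 x u) = (\<Sum>u\<in>N W x. ?i 1 u + 2 * ?i 2 u + 3 * ?i 3 u)"
  proof (rule sum.cong[OF refl])
    fix u assume "u \<in> N W x"
    from cases[OF this] show "leg_length W 4 x u = ?i 1 u + 2 * ?i 2 u + 3 * ?i 3 u" by (elim disjE) simp_all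
  qed
  then show "(\<Sum>u\<in>N W x. leg_length W 4 x u) = leg_count W 1 x + 2 * leg_count W 2 x + 3 * leg_count W 3 x"
    unfolding leg_count_sum[OF fin] sum.distrib sum_distrib_left by simp
  have "(\<Sum>u\<in>N W x. weight W x {} u) \<le> (\<Sum>u\<in>N W x. 2 * ?i 0 u + ?i 1 u)"
    by (rule sum_mono) (auto simp: weight_def)
  then show "(\<Sum>u\<in>N W x. weight W x {} u) \<le> 2 * leg_count W 0 x + leg_count W 1 x"
    unfolding leg_count_sum[OF fin] sum.distrib sum_distrib_left by simp
  assume b: "b \<in> N W x" "leg_length W 4 x b = 0"
  have "(\<Sum>u\<in>N W x. weight W x {b} u) + (\<Sum>u\<in>N W x. if u = b then 2 else 0) \<le> (\<Sum>u\<in>N W x. 2 * ?i 0 u + ?i 1 u)"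
    unfolding sum.distrib[symmetric] by (rule sum_mono) (use b in \<open>auto simp: weight_def\<close>)
  moreover have "(\<Sum>u\<in>N W x. if u = b then 2 else 0) = (2::nat)" using b finN by simp
  ultimately show "(\<Sum>u\<in>N W x. weight W x {b} u) + 2 \<le> 2 * leg_count W 0 x + leg_count W 1 x"
    unfolding leg_count_sum[OF fin] sum.distrib sum_distrib_left by simp
qed

text \<open>Otherwise the only 0-leg of \<open>u\<close> would weigh 1 instead of 2, and the total
  weight 2 at \<open>u\<close> contradicts \<open>weight_leg3\<close>.\<close>

lemma poor_neighbour_even:
  assumes min: "minimal_uncolorable W" and v: "v \<in> W" and u: "u \<in> N W v"
    and poor: "poor W u" "leg_length W 4 u v = 0"
  shows "even (card (N W v))"
proof (rule ccontr)
  assume odd: "odd (card (N W v))"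
  have fin: "finite W" using min by (simp add: minimal_uncolorable_def)
  have uW: "u \<in> W" using u by (simp add: N_def)
  have vu: "v \<in> N W u" using N_sym[OF v u] .
  obtain v' where v': "{w \<in> N W u. leg_length W 4 u w = 0} = {v'}"
    using poor by (auto simp: poor_def leg_count_def card_1_singleton_iff)
  have only: "w = v" if "w \<in> N W u" "leg_length W 4 u w = 0" for w
  proof -
    have "w \<in> {v'}" "v \<in> {v'}" unfolding v'[symmetric] using that poor vu by auto
    then show ?thesis by simp
  qed
  have "(\<Sum>w\<in>N W u. weight W u {} w) \<le>
      (\<Sum>w\<in>N W u. of_bool (leg_length W 4 u w = 0) + of_bool (leg_length W 4 u w = 1))"
    by (rule sum_mono) (use only odd in \<open>auto simp: weight_def\<close>)
  also have "\<dots> = leg_count W 0 u + leg_count W 1 u"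
    unfolding leg_count_sum[OF fin] sum.distrib ..
  also have "\<dots> = 2" using poor by (simp add: poor_def)
  finally have le: "(\<Sum>w\<in>N W u. weight W u {} w) \<le> 2" .
  have "{w \<in> N W u. leg_length W 4 u w = 3} \<noteq> {}"
    using poor unfolding poor_def leg_count_def by (metis card.empty zero_neq_numeral)
  then obtain u3 where "u3 \<in> N W u - {}" "leg_length W 4 u u3 = 3" by blast
  from weight_leg3[OF min uW _ this] le show False by (simp add: free_set_def)
qed

definition poor_neighbours :: "'a set \<Rightarrow> 'a \<Rightarrow> 'a set" where
  "poor_neighbours W v = {u \<in> N W v. poor W u \<and> leg_length W 4 u v = 0}"

text \<open>The charge \<open>4 d - 10\<close> covers one unit per leg vertex and one per poor
  neighbour, where a poor vertex may also use the unit it receives.\<close>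

lemma final_charge:
  assumes min: "minimal_uncolorable W" and v: "v \<in> W" and deg: "card (N W v) \<noteq> 2"
  shows "(\<Sum>u\<in>N W v. leg_length W 4 v u) + 10 + card (poor_neighbours W v) \<le> 4 * card (N W v) + of_bool (poor W v)"
proof -
  have fin: "finite W" using min by (simp add: minimal_uncolorable_def)
  have finN: "finite (N W v)" using fin by (simp add: N_def)
  note counts = leg_counts[OF min v]
  have deg3: "3 \<le> card (N W v)" using minimal_degree[OF min v] deg by linarith
  have ex: "\<exists>u\<in>N W v. leg_length W 4 v u = k" if "leg_count W k v \<noteq> 0" for k
    using that unfolding leg_count_def by (metis (mono_tags, lifting) card.empty empty_Collect_eq)
  show ?thesis
  proof (cases "odd (card (N W v))")
    case True
    then have z: "poor_neighbours W v = {}"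
      using poor_neighbour_even[OF min v] by (auto simp: poor_neighbours_def)
    have "leg_count W 2 v = 0" "leg_count W 3 v = 0"
      using legs_at_odd[OF min v _ True] ex[of 2] ex[of 3] by fastforce+
    \<comment> \<open>All legs have length 0 or 1. For degree 3 the weight forces a 0-leg, so at
      most 2 units are paid out of 2; for degree \<open>d \<ge> 5\<close>, at most \<open>d\<close>
      out of \<open>4 d - 10\<close>.\<close>
    then show ?thesis
      using counts(1,2,3) weight_odd[OF min v True] z deg3 True by (auto elim!: oddE)
  next
    case False
    then have ev: "even (leg_count W 0 v + leg_count W 1 v + leg_count W 2 v + leg_count W 3 v)"
      and ge3: "3 \<le> leg_count W 0 v + leg_count W 1 v + leg_count W 2 v + leg_count W 3 v"
      using counts(1) deg3 by auto
    have poor0: "leg_length W 4 v u = 0" if "u \<in> poor_neighbours W v" for u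
      using that by (simp add: poor_neighbours_def poor_def leg_length_rec)
    then have zle: "card (poor_neighbours W v) \<le> leg_count W 0 v"
      unfolding leg_count_def using finN by (intro card_mono) (auto simp: poor_neighbours_def)
    \<comment> \<open>One poor neighbour is turned into a branch if there is any; this choice feeds
      both charge estimates.\<close>
    define B where "B = (if poor_neighbours W v = {} then {} else {SOME b. b \<in> poor_neighbours W v})"
    have B: "B = {} \<and> card (poor_neighbours W v) = 0 \<or> (\<exists>b \<in> poor_neighbours W v. B = {b})"
      unfolding B_def using some_in_eq by auto
    then have fr: "free_set W v B" by (auto simp: free_set_def poor_neighbours_def)
    have notB: "u \<notin> B" if "leg_length W 4 v u \<noteq> 0" for u using B that poor0 by auto
    have w3: "2 < (\<Sum>u\<in>N W v. weight W v B u)" if "leg_count W 3 v \<noteq> 0"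
      using ex[OF that] weight_leg3[OF min v fr] notB by fastforce
    have w2: "1 < (\<Sum>u\<in>N W v. weight W v B u)" if "leg_count W 2 v \<noteq> 0"
      using ex[OF that] weight_leg2[OF min v fr] notB by fastforce
    from B show ?thesis
    proof
      assume B0: "B = {} \<and> card (poor_neighbours W v) = 0"
      show ?thesis
      proof (cases "leg_count W 0 v = 1 \<and> leg_count W 1 v = 1 \<and> leg_count W 2 v = 0 \<and> leg_count W 3 v = 2")
        case True
        then show ?thesis using counts(1,2) B0 by (simp add: poor_def)
      next
        case False
        then show ?thesis
          using charge_without_poor_neighbour[OF counts(3) _ _ ge3 ev] w3 w2 B0 counts(1,2) by simp
      qed
    next
      assume "\<exists>b \<in> poor_neighbours W v. B = {b}"
      then obtain b where b: "b \<in> poor_neighbours W v" "B = {b}" by blast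
      then have le: "(\<Sum>u\<in>N W v. weight W v B u) + 2 \<le> 2 * leg_count W 0 v + leg_count W 1 v"
        using counts(4)[of b] poor0 by (auto simp: poor_neighbours_def)
      then have "(\<Sum>u\<in>N W v. leg_length W 4 v u) + 10 + card (poor_neighbours W v) \<le> 4 * card (N W v)"
        using charge_with_poor_neighbour[OF le w3 w2 ge3 ev zle] counts(1,2) by simp
      then show ?thesis by simp
    qed
  qed
qed

text \<open>The leg lengths telescope along each path of 2-vertices.\<close>

lemma leg_length_transfer:
  assumes min: "minimal_uncolorable W"
  shows "(\<Sum>v\<in>{v\<in>W. card (N W v) \<noteq> 2}. \<Sum>u\<in>N W v. leg_length W 4 v u) = 2 * card {v\<in>W. card (N W v) = 2}"
proof -
  have fin: "finite W" using min by (simp add: minimal_uncolorable_def)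
  have finN: "finite (N W v)" for v using fin by (simp add: N_def)
  define A where "A = (SIGMA w:W. N W w)"
  define H where "H = {(w, v) \<in> A. card (N W v) = 2}"
  define T where "T = (SIGMA w:{v\<in>W. card (N W v) = 2}. N W w)"
  define R where "R = (SIGMA w:{v\<in>W. card (N W v) \<noteq> 2}. N W w)"
  let ?k = "\<lambda>(w, v). leg_length W 4 w v"
  have finA: "finite A" using fin finN by (auto simp: A_def)
  have ATR: "A = T \<union> R" "T \<inter> R = {}" by (auto simp: A_def T_def R_def)
  have finTR: "finite T" "finite R" using finA ATR by auto
  \<comment> \<open>Moving on by one arc maps the arcs with a 2-vertex as head onto the arcs with a
    2-vertex as tail, and shortens the leg by exactly 1. In the difference of the two sums only arcs
    leaving non-2-vertices remain.\<close>
  have bij: "bij_betw (\<lambda>(w, v). (v, other W v w)) H T"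
  proof (rule bij_betw_byWitness[where f' = "\<lambda>(v, u). (other W v u, v)"])
    have o: "other W v w \<in> N W v" "other W v (other W v w) = w" "w \<in> W" "v \<in> W"
      if w: "w \<in> N W v" and v: "card (N W v) = 2" "v \<in> W" for v w
    proof -
      note o = other[OF v(1) w]
      show "other W v w \<in> N W v" using o by auto
      show "other W v (other W v w) = w" using o by (intro other_eq) auto
    qed (use w v in \<open>auto simp: N_def\<close>)
    have H: "(w, v) \<in> H \<Longrightarrow> w \<in> N W v \<and> card (N W v) = 2 \<and> v \<in> W" for w v
      using N_sym by (auto simp: H_def A_def N_def)
    show "\<forall>a\<in>H. (\<lambda>(v, u). (other W v u, v)) ((\<lambda>(w, v). (v, other W v w)) a) = a"
      using o H by auto
    show "\<forall>a'\<in>T. (\<lambda>(w, v). (v, other W v w)) ((\<lambda>(v, u). (other W v u, v)) a') = a'"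
      using o by (auto simp: T_def)
    show "(\<lambda>(w, v). (v, other W v w)) ` H \<subseteq> T"
      using o H by (auto simp: T_def)
    show "(\<lambda>(v, u). (other W v u, v)) ` T \<subseteq> H"
    proof clarify
      fix v u assume "(v, u) \<in> T"
      then have vu: "u \<in> N W v" "card (N W v) = 2" "v \<in> W" by (auto simp: T_def)
      note o' = o(1)[OF vu]
      have "other W v u \<in> W" using o' by (simp add: N_def)
      moreover have "v \<in> N W (other W v u)" using N_sym[OF vu(3) o'] .
      ultimately show "(other W v u, v) \<in> H" using vu by (simp add: H_def A_def)
    qed
  qed
  have rec: "?k a = 1 + ?k ((\<lambda>(w, v). (v, other W v w)) a)" if "a \<in> H" for a
  proof -
    obtain w v where a: "a = (w, v)" "w \<in> W" "v \<in> N W w" "card (N W v) = 2"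
      using \<open>a \<in> H\<close> by (auto simp: H_def A_def)
    have vW: "v \<in> W" using a by (simp add: N_def)
    have "w \<in> N W v" using N_sym a by blast
    then have "other W v w \<in> N W v" using other[OF a(4)] by auto
    then have "leg_length W 4 v (other W v w) \<le> 3" using legs_short[OF min vW] by blast
    \<comment> \<open>The recursion leaves cut-off 3; as the leg has at most 3 vertices, cut-off 4
      gives the same length.\<close>
    then have "leg_length W 3 v (other W v w) = leg_length W 4 v (other W v w)"
      using leg_length_stable[of W 3] by simp
    then show ?thesis using a by (simp add: leg_length_rec[of W w v])
  qed
  have "(\<Sum>a\<in>A. ?k a) = (\<Sum>a\<in>H. ?k a)"
    using finA by (intro sum.mono_neutral_right) (auto simp: H_def leg_length_rec split: if_splits)
  also have "\<dots> = (\<Sum>a\<in>H. 1 + ?k ((\<lambda>(w, v). (v, other W v w)) a))" using rec by (rule sum.cong[OF refl])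
  also have "\<dots> = card H + (\<Sum>a\<in>T. ?k a)"
    unfolding sum.distrib using sum.reindex_bij_betw[OF bij, of ?k] by simp
  finally have "(\<Sum>a\<in>R. ?k a) = card H"
    using sum.union_disjoint[OF finTR ATR(2), of ?k] ATR(1) by simp
  also have "\<dots> = card T" using bij_betw_same_card[OF bij] .
  also have "\<dots> = 2 * card {v\<in>W. card (N W v) = 2}"
    unfolding T_def using fin finN by (subst card_SigmaI) auto
  finally show ?thesis unfolding R_def using fin finN by (subst (asm) sum.Sigma[symmetric]) auto
qed

text \<open>The neighbour of a poor vertex at its 0-leg has degree other than 2, and counts that
  vertex among its poor neighbours.\<close>

lemma poor_transfer:
  assumes min: "minimal_uncolorable W"
  shows "(\<Sum>v\<in>{v\<in>W. card (N W v) \<noteq> 2}. of_bool (poor W v)) \<le>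
    (\<Sum>v\<in>{v\<in>W. card (N W v) \<noteq> 2}. card (poor_neighbours W v))"
proof -
  have fin: "finite W" using min by (simp add: minimal_uncolorable_def)
  let ?D = "{v\<in>W. card (N W v) \<noteq> 2}"
  have "\<exists>v. v \<in> ?D \<and> u \<in> poor_neighbours W v" if u: "u \<in> W" "poor W u" for u
  proof -
    have "{w \<in> N W u. leg_length W 4 u w = 0} \<noteq> {}"
      using u unfolding poor_def leg_count_def by (metis card.empty zero_neq_one)
    then obtain v where v: "v \<in> N W u" "leg_length W 4 u v = 0" by blast
    then have "v \<in> ?D" by (auto simp: N_def leg_length_rec split: if_splits)
    moreover have "u \<in> N W v" using N_sym[OF u(1) v(1)] .
    ultimately show ?thesis using v u by (auto simp: poor_neighbours_def)
  qed
  then have "{v\<in>?D. poor W v} \<subseteq> (\<Union>v\<in>?D. poor_neighbours W v)" by blast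
  moreover have "finite (\<Union>v\<in>?D. poor_neighbours W v)" using fin by (auto simp: poor_neighbours_def N_def)
  ultimately have "card {v\<in>?D. poor W v} \<le> card (\<Union>v\<in>?D. poor_neighbours W v)" by (intro card_mono)
  also have "\<dots> \<le> (\<Sum>v\<in>?D. card (poor_neighbours W v))" using fin by (intro card_UN_le) auto
  finally show ?thesis using fin by (simp add: Int_def conj_assoc)
qed

text \<open>Summing the final charges: the leg payments amount to 2 per 2-vertex, which cancels the
  charge -2 there, so the sum of \<open>4 d - 10\<close> over \<open>W\<close> is
  nonnegative.\<close>

theorem minimal_uncolorable_dense:
  assumes min: "minimal_uncolorable W"
  shows "5 * card W \<le> 2 * (\<Sum>v\<in>W. card (N W v))"
proof -
  have fin: "finite W" using min by (simp add: minimal_uncolorable_def)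
  let ?D = "{v\<in>W. card (N W v) \<noteq> 2}" and ?T = "{v\<in>W. card (N W v) = 2}"
  have W: "W = ?D \<union> ?T" "?D \<inter> ?T = {}" by auto
  have cardW: "card W = card ?D + card ?T"
    using card_Un_disjoint[of ?D ?T] W fin by auto
  have "(\<Sum>v\<in>W. card (N W v)) = (\<Sum>v\<in>?D. card (N W v)) + (\<Sum>v\<in>?T. card (N W v))"
    using sum.union_disjoint[of ?D ?T "\<lambda>v. card (N W v)"] W fin by auto
  moreover have "(\<Sum>v\<in>?T. card (N W v)) = 2 * card ?T" by simp
  moreover have "(\<Sum>v\<in>?D. (\<Sum>u\<in>N W v. leg_length W 4 v u) + 10 + card (poor_neighbours W v)) \<le>
      (\<Sum>v\<in>?D. 4 * card (N W v) + of_bool (poor W v))"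
    using final_charge[OF min] by (intro sum_mono) auto
  then have "2 * card ?T + 10 * card ?D \<le> 4 * (\<Sum>v\<in>?D. card (N W v))"
    using leg_length_transfer[OF min] poor_transfer[OF min]
    unfolding sum.distrib sum_distrib_left[symmetric] by simp
  ultimately show ?thesis using cardW by simp
qed

theorem odd_colorable4_if_sparse:
  assumes "finite V" and sparse: "\<And>W. \<lbrakk>W \<subseteq> V; W \<noteq> {}\<rbrakk> \<Longrightarrow> 2 * (\<Sum>v\<in>W. card (N W v)) < 5 * card W"
  shows "odd_colorable4 V"
proof -
  have "odd_colorable4 W" if "W \<subseteq> V" for W
    using finite_subset[OF that \<open>finite V\<close>] that
  proof (induction W rule: finite_psubset_induct)
    case (psubset W)
    show ?case
    proof (rule ccontr)
      assume no: "\<not> odd_colorable4 W"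
      then have "W \<noteq> {}" by (auto simp: odd_colorable4_def)
      moreover have "minimal_uncolorable W" using no psubset by (auto simp: minimal_uncolorable_def)
      ultimately show False
        using minimal_uncolorable_dense sparse[OF psubset.prems] by fastforce
    qed
  qed
  then show ?thesis by blast
qed

end

section \<open>Odd colorings of planar graphs\<close>

fun arc_list :: "'a list \<Rightarrow> ('a \<times> 'a) list" where
  "arc_list (u # v # r) = (u, v) # arc_list (v # r)"
| "arc_list _ = []"

lemma arc_list_walk:
  "ws \<noteq> [] \<Longrightarrow> pre_digraph.cas (with_proj G) (hd ws) (arc_list ws) (last ws)"
  "ws \<noteq> [] \<Longrightarrow> pre_digraph.awalk_verts (with_proj G) (hd ws) (arc_list ws) = ws"
  "length (arc_list ws) = length ws - 1"
  "successively (\<lambda>u v. (u, v) \<in> parcs G) ws \<Longrightarrow> set (arc_list ws) \<subseteq> parcs G"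
  by (induction ws rule: arc_list.induct)
     (auto simp: pre_digraph.cas.simps pre_digraph.awalk_verts.simps)

lemma orderings_of_pair:
  "finite {(u, v). {u, v} = {a, b}}" "card {(u, v). {u, v} = {a, b}} \<le> 2"
proof -
  have eq: "{(u, v). {u, v} = {a, b}} = {(a, b), (b, a)}" by (auto simp: doubleton_eq_iff)
  show "finite {(u, v). {u, v} = {a, b}}" unfolding eq by simp
  show "card {(u, v). {u, v} = {a, b}} \<le> 2" unfolding eq by (cases "a = b") auto
qed

lemma (in pair_graph) arc_sym: "(u, v) \<in> parcs G \<Longrightarrow> (v, u) \<in> parcs G"
  using pair_sym_arcs by (auto simp: symmetric_def dest: symD)

lemma (in pair_graph) edge_iff: "{u, v} \<in> edges G \<longleftrightarrow> (u, v) \<in> parcs G"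
  using arc_sym by (auto simp: edges_def doubleton_eq_iff)

lemma (in pair_graph) cycle_list_length:
  assumes "10 \<le> girth G" "distinct vs" "3 \<le> length vs" "successively (\<lambda>u v. (u, v) \<in> parcs G) vs"
    "(last vs, hd vs) \<in> parcs G"
  shows "10 \<le> length vs"
proof -
  \<comment> \<open>Repeating the first vertex gives the closed walk as many arcs as
    \<open>vs\<close> has vertices, so its length is the one measured by
    \<open>girth\<close>.\<close>
  define ws where "ws = vs @ [hd vs]"
  define p where "p = arc_list ws"
  have ne: "vs \<noteq> []" "ws \<noteq> []" using assms(3) by (auto simp: ws_def)
  have hl: "hd ws = hd vs" "last ws = hd vs" using ne by (auto simp: ws_def)
  have suc: "successively (\<lambda>u v. (u, v) \<in> parcs G) ws"
    using assms(4,5) ne by (auto simp: ws_def successively_append_iff)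
  have len: "length p = length vs" by (simp add: p_def arc_list_walk(3) ws_def)
  have "hd vs \<in> pverts G" using in_arcsD2[OF assms(5)] .
  then have "pre_digraph.awalk (with_proj G) (hd vs) p (hd vs)"
    using arc_list_walk(1)[OF ne(2), of G] arc_list_walk(4)[OF suc]
    by (simp add: pre_digraph.awalk_def p_def hl)
  moreover have "distinct (tl (pre_digraph.awalk_verts (with_proj G) (hd vs) p))"
    using arc_list_walk(2)[OF ne(2), of G] assms(2) ne(1)
    by (cases vs) (auto simp: p_def hl ws_def)
  moreover have "p \<noteq> []" using len assms(3) by auto
  ultimately have "pre_digraph.cycle (with_proj G) p" by (auto simp: pre_digraph.cycle_def)
  then have "girth G \<le> enat (length p)"
    unfolding girth_def using assms(3) len by (intro INF_lower) auto
  then have "10 \<le> enat (length vs)" using assms(1) len by (metis order_trans)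
  then show ?thesis by (simp add: numeral_eq_enat)
qed

lemma (in pair_graph) plane_graph_of_drawing:
  assumes "plane_drawing G pos \<gamma>" "10 \<le> girth G"
  shows "plane_graph (pverts G) (edges G) pos \<gamma>"
proof
  have sub: "e \<subseteq> pverts G" if "e \<in> edges G" for e
    using that in_arcsD1 in_arcsD2 by (auto simp: edges_def)
  then show "e \<subseteq> pverts G" if "e \<in> edges G" for e using that .
  show "finite (pverts G)" by (rule pair_finite_verts)
  have "edges G \<subseteq> Pow (pverts G)" using sub by blast
  then show "finite (edges G)" using pair_finite_verts finite_subset by blast
  show "\<exists>u v. u \<noteq> v \<and> e = {u, v}" if "e \<in> edges G" for e
    using that pair_no_loops by (fastforce simp: edges_def)
  show "10 \<le> length vs" if "cycle_in (edges G) vs" for vs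
    using that cycle_list_length[OF assms(2)] by (simp add: cycle_in_def edge_iff)
qed (use assms(1) in \<open>auto simp: plane_drawing_def\<close>)

theorem theorem1p1:
  fixes G :: "'a pair_pre_digraph"
  assumes "pair_graph G"
    and "planar G"
    and "girth G \<ge> 10"
  shows "odd_chromatic_number G \<le> 4"
proof -
  interpret pair_graph G by fact
  obtain pos \<gamma> where dr: "plane_drawing G pos \<gamma>" using assms(2) by (auto simp: planar_def)
  interpret plane_graph "pverts G" "edges G" pos \<gamma> by (rule plane_graph_of_drawing[OF dr assms(3)])
  define E where "E u v \<longleftrightarrow> (u, v) \<in> parcs G" for u v
  interpret girth10_graph E
  proof
    show "E u v \<Longrightarrow> E v u" for u v using arc_sym by (simp add: E_def)
    show "\<not> E v v" for v using pair_no_loops[of "(v, v)"] by (auto simp: E_def)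
    show "10 \<le> length vs" if "distinct vs" "3 \<le> length vs" "successively E vs" "E (last vs) (hd vs)" for vs
      using cycle_list_length[OF assms(3) that(1,2)] that(3,4) by (simp add: E_def[abs_def])
  qed
  have "odd_colorable4 (pverts G)"
  proof (rule odd_colorable4_if_sparse[OF pair_finite_verts])
    fix W assume W: "W \<subseteq> pverts G" "W \<noteq> {}"
    have finW: "finite W" using W(1) pair_finite_verts finite_subset by blast
    define F where "F = {e \<in> edges G. e \<subseteq> W}"
    have sub: "subgraph_of F W" using W(1) by (auto simp: subgraph_of_def F_def)
    \<comment> \<open>Ordered adjacent pairs: their number is the degree sum, and every edge of
      \<open>F\<close> accounts for at most two of them.\<close>
    define A where "A = (SIGMA v:W. N W v)"
    have "A \<subseteq> (\<Union>e\<in>F. {(u, v). {u, v} = e})"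
      by (auto simp: A_def N_def F_def E_def edge_iff)
    moreover have fib: "finite {(u, v). {u, v} = e} \<and> card {(u, v). {u, v} = e} \<le> 2" if e: "e \<in> F" for e
    proof -
      have "e \<in> edges G" using e by (simp add: F_def)
      then obtain a b where "e = {a, b}" unfolding edges_def by blast
      then show ?thesis using orderings_of_pair[of a b] by simp
    qed
    moreover have finF: "finite F" using subgraph_ofD(4)[OF sub] .
    ultimately have "card A \<le> card (\<Union>e\<in>F. {(u, v). {u, v} = e})" by (intro card_mono) auto
    also have "\<dots> \<le> (\<Sum>e\<in>F. card {(u, v). {u, v} = e})" by (rule card_UN_le[OF finF])
    also have "\<dots> \<le> (\<Sum>e\<in>F. 2)" using fib by (intro sum_mono) blast
    finally have "card A \<le> 2 * card F" by simp
    moreover have "card A = (\<Sum>v\<in>W. card (N W v))"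
      unfolding A_def using finW by (intro card_SigmaI) (auto simp: N_def)
    ultimately show "2 * (\<Sum>v\<in>W. card (N W v)) < 5 * card W" using sparse[OF sub W(2)] by linarith
  qed
  then obtain c where c: "\<And>v. v \<in> pverts G \<Longrightarrow> vertex_ok (pverts G) c v" by (auto simp: odd_colorable4_def)
  have nb: "nbrs G v = N (pverts G) v" for v
    using in_arcsD2 by (auto simp: nbrs_def N_def E_def)
  have "c u \<noteq> c v" if "(u, v) \<in> parcs G" for u v
    using c[OF in_arcsD2[OF that]] that arc_sym[OF that] in_arcsD1[OF that]
    by (auto simp: vertex_ok_def N_def E_def)
  then have "odd_coloring G c"
    using c by (auto simp: odd_coloring_def proper_coloring_def nb vertex_ok_def)
  then have "odd_chromatic_number G \<le> card (c ` pverts G)"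
    unfolding odd_chromatic_number_def by (intro Least_le) blast
  also have "\<dots> \<le> card {..<4::nat}"
    using c by (intro card_mono) (auto simp: vertex_ok_def)
  finally show ?thesis by simp
qed

end
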